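(* Let $\lambda,\mu>0$, $\xi>0$, $\alpha\in(0,1]$, and let $\{X^\alpha_t\}_{t\ge0}$ be a fractional $M/M/1$ queue with catastrophes of parameter $\alpha$ (arrival rate $\lambda$, service rate $\mu$, catastrophe rate $\xi$) started from $X^\alpha_0=i$, with $P^\alpha_{i,n}(t)=P(X^\alpha_t=n\mid X^\alpha_0=i)$. Then for every $t>0$ the variance of $X^\alpha_t$ is $$\begin{aligned}\mathrm{Var}(X^\alpha_t)=\;&i^2E^1_{\alpha,1}(-\xi t^\alpha)+2it^\alpha(\lambda-\mu)E^2_{\alpha,\alpha+1}(-\xi t^\alpha)-\mu\,[P^\alpha_{i,0}(t)\ast t^{\alpha-1}E^1_{\alpha,\alpha}(-\xi t^\alpha)]\\&+2\mu(\lambda-\mu)\,[P^\alpha_{i,0}(t)\ast t^{2\alpha-1}E^2_{\alpha,2\alpha}(-\xi t^\alpha)]+(\mu+\lambda)t^\alpha E^1_{\alpha,\alpha+1}(-\xi t^\alpha)\\&+2t^{2\alpha}(\lambda-\mu)^2E^2_{\alpha,2\alpha+1}(-\xi t^\alpha)\\&-\left[iE^1_{\alpha,1}(-\xi t^\alpha)+\mu\,P^\alpha_{i,0}(t)\ast t^{\alpha-1}E^1_{\alpha,\alpha}(-\xi t^\alpha)+\frac{\lambda-\mu}{\xi}\left(1-E^1_{\alpha,1}(-\xi t^\alpha)\right)\right]^2.\end{aligned}$$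
   Context: Fractional queue. For $\alpha\in(0,1]$, $\lambda,\mu>0$, $\xi\ge0$, a fractional $M/M/1$ queue with catastrophes of parameter $\alpha$ is a continuous-time stochastic process $\{X^\alpha_t\}_{t\ge0}$ with values in $\{0,1,2,\dots\}$ whose transition probabilities $P^\alpha_{i,n}(t):=P(X^\alpha_t=n\mid X^\alpha_0=i)$ satisfy, for $t>0$ and $i\ge0$, $$D^\alpha_tP^\alpha_{i,0}(t)=-(\lambda+\xi)P^\alpha_{i,0}(t)+\mu P^\alpha_{i,1}(t)+\xi,$$ $$D^\alpha_tP^\alpha_{i,n}(t)=-(\lambda+\mu+\xi)P^\alpha_{i,n}(t)+\lambda P^\alpha_{i,n-1}(t)+\mu P^\alpha_{i,n+1}(t)\quad(n\ge1),$$ $$P^\alpha_{i,n}(0)=\delta_{i,n}\ \text{(Kronecker delta)},$$ where for $\alpha\in(0,1)$ $D^\alpha_t f(t)=\frac{1}{\Gamma(1-\alpha)}\int_0^t\frac{f'(s)}{(t-s)^\alpha}ds$ is the Caputo derivative, and for $\alpha=1$ $D^1_t=d/dt$. Notation. $E^\delta_{\beta,\gamma}(w)=\sum_{r=0}^\infty\frac{w^r\,\Gamma(\delta+r)}{r!\,\Gamma(\beta r+\gamma)\,\Gamma(\delta)}$ is the three-parameter Mittag-Leffler function ($\Re\beta>0$). The convolution in $t$ is $f(t)\ast g(t)=\int_0^t f(u)g(t-u)\,du$. *)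

theory Defs
  imports "HOL-Probability.Probability"
begin

definition mittag_leffler3 :: "'a :: Gamma \<Rightarrow> 'a \<Rightarrow> 'a \<Rightarrow> 'a \<Rightarrow> 'a" where
  "mittag_leffler3 \<delta> \<beta> \<gamma> w =
     (\<Sum>r. w ^ r * Gamma (\<delta> + of_nat r) / (fact r * Gamma (\<beta> * of_nat r + \<gamma>) * Gamma \<delta>))"

definition time_convolution :: "(real \<Rightarrow> real) \<Rightarrow> (real \<Rightarrow> real) \<Rightarrow> real \<Rightarrow> real" where
  "time_convolution f g t = (LBINT u=0..t. f u * g (t - u))"

definition caputo_deriv :: "real \<Rightarrow> (real \<Rightarrow> real) \<Rightarrow> real \<Rightarrow> real" where
  "caputo_deriv \<alpha> f t =
     (if \<alpha> = 1 then deriv f t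
      else 1 / Gamma (1 - \<alpha>) * (LBINT s=0..t. deriv f s / (t - s) powr \<alpha>))"

(* caputo_deriv is a total function; this predicate says that its value is meaningful.
   Continuity on the closed interval (in particular at 0) belongs to the notion: the Caputo
   derivative only sees f on (0, t], so otherwise f 0 would not act as an initial value.
   For \<alpha> < 1, integrability of the kernel-weighted derivative makes deriv f itself
   integrable on (0, t), as (t - s) powr (- \<alpha>) is bounded below there. *)
definition caputo_differentiable :: "real \<Rightarrow> (real \<Rightarrow> real) \<Rightarrow> real \<Rightarrow> bool" where
  "caputo_differentiable \<alpha> f t \<longleftrightarrow>
     continuous_on {0..t} f \<and>
     (if \<alpha> = 1 then f differentiable (at t)
      else (\<forall>s\<in>{0<..<t}. f differentiable (at s)) \<and>
           interval_lebesgue_integrable lborel 0 t (\<lambda>s. deriv f s / (t - s) powr \<alpha>))"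

definition trans_prob :: "'a measure \<Rightarrow> (real \<Rightarrow> 'a \<Rightarrow> nat) \<Rightarrow> nat \<Rightarrow> nat \<Rightarrow> real \<Rightarrow> real" where
  "trans_prob M X i n t = \<P>(\<omega> in M. X t \<omega> = n \<bar> X 0 \<omega> = i)"

(* Conditioning on X 0 = i only makes sense if this event has positive probability, so the
   equations are imposed for exactly those initial states i. *)
locale fractional_mm1_queue = prob_space M for M :: "'a measure" +
  fixes X :: "real \<Rightarrow> 'a \<Rightarrow> nat" and \<alpha> lam \<mu> \<xi> :: real
  assumes order: "0 < \<alpha>" "\<alpha> \<le> 1"
    and rates: "0 < lam" "0 < \<mu>" "0 \<le> \<xi>"
    and random_variables: "\<And>t. 0 \<le> t \<Longrightarrow> random_variable (count_space UNIV) (X t)"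
    and caputo_differentiable:
      "\<And>i n t. \<lbrakk>0 < prob {\<omega> \<in> space M. X 0 \<omega> = i}; 0 < t\<rbrakk> \<Longrightarrow>
         caputo_differentiable \<alpha> (trans_prob M X i n) t"
    and equation_0:
      "\<And>i t. \<lbrakk>0 < prob {\<omega> \<in> space M. X 0 \<omega> = i}; 0 < t\<rbrakk> \<Longrightarrow>
         caputo_deriv \<alpha> (trans_prob M X i 0) t =
           - (lam + \<xi>) * trans_prob M X i 0 t + \<mu> * trans_prob M X i 1 t + \<xi>"
    and equation_n:
      "\<And>i n t. \<lbrakk>0 < prob {\<omega> \<in> space M. X 0 \<omega> = i}; 0 < t; 1 \<le> n\<rbrakk> \<Longrightarrow>
         caputo_deriv \<alpha> (trans_prob M X i n) t =
           - (lam + \<mu> + \<xi>) * trans_prob M X i n t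
           + lam * trans_prob M X i (n - 1) t + \<mu> * trans_prob M X i (n + 1) t"
    and initial:
      "\<And>i n. 0 < prob {\<omega> \<in> space M. X 0 \<omega> = i} \<Longrightarrow>
         trans_prob M X i n 0 = (if n = i then 1 else 0)"

end

theory Submission
  imports Defs
begin

text \<open>
  Write \<open>J\<^sup>a\<close> for the Riemann-Liouville integral of order \<open>a\<close>. Inverting the Caputo derivative
  (\<open>caputo_deriv_inverse\<close>) turns the forward equations into Volterra equations, and testing these
  against a function \<open>\<phi>\<close> of the queue length gives Dynkin's formula
  \<open>E \<phi>(X\<^sub>t) = \<phi>(i) + J\<^sup>\<alpha>(E (A \<phi>)(X\<^sub>s))(t)\<close> with the generator \<open>A\<close> of the classical queue with
  catastrophes. For eventually constant \<open>\<phi>\<close> this involves finitely many equations only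
  (\<open>dynkin_eventually_const\<close>).

  The second moment is not assumed to be finite. Because of the catastrophes, the generator of the
  truncated square \<open>(min n N)\<^sup>2\<close> is at most \<open>lam + lam\<^sup>2 / \<xi>\<close>, whatever \<open>N\<close> is
  (\<open>generator_truncated_square_le\<close>). Hence \<open>E X\<^sub>t\<^sup>2\<close> is finite and bounded on bounded time intervals, and dominated
  convergence extends Dynkin's formula to functions of quadratic growth (\<open>dynkin_quadratic\<close>).

  Taking \<open>\<phi>(n) = n\<close> and \<open>\<phi>(n) = n\<^sup>2\<close> shows that the moments \<open>m\<^sub>1\<close> and \<open>m\<^sub>2\<close> satisfy
  \<open>m\<^sub>1 = i + J\<^sup>\<alpha>(lam - \<mu> + \<mu> P\<^sub>0 - \<xi> m\<^sub>1)\<close> and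
  \<open>m\<^sub>2 = i\<^sup>2 + J\<^sup>\<alpha>(lam + \<mu> - \<mu> P\<^sub>0 + 2 (lam - \<mu>) m\<^sub>1 - \<xi> m\<^sub>2)\<close>, where \<open>P\<^sub>0(t)\<close> is the probability
  that the queue is empty at time \<open>t\<close>. An equation of this
  form is solved by its Neumann series, whose terms are \<open>(-\<xi>)\<^sup>k J\<^bsup>k\<alpha>\<^esup>\<close> by the semigroup law and which sums
  to Mittag-Leffler functions and convolutions with Mittag-Leffler kernels (\<open>volterra_solution\<close>).
  Inserting the solution \<open>m\<^sub>1\<close> into the equation for \<open>m\<^sub>2\<close> iterates the kernel; the order \<open>r\<close> of the
  product of two geometric series has weight \<open>r + 1\<close>, which is the coefficient that belongs to
  \<open>\<delta> = 2\<close> (\<open>ml_convolution_volterra_solution\<close>).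
\<close>

section \<open>Mittag-Leffler series\<close>

text \<open>The Gamma function dominates every exponential: bound Euler's integral from below by its part
  over \<open>[A, A + 1]\<close>.\<close>

lemma Gamma_real_ge_powr:
  fixes z A :: real
  assumes "0 < z" "1 \<le> A"
  shows "A powr z * (exp (- (A + 1)) / (A + 1)) \<le> Gamma z"
proof -
  have 1: "((\<lambda>s. A powr z * (exp (- (A + 1)) / (A + 1))) has_integral
      (A powr z * (exp (- (A + 1)) / (A + 1)))) {A..A+1}"
    using has_integral_const_real[of "A powr z * (exp (- (A + 1)) / (A + 1))" A "A+1"] by simp
  note 2 = Gamma_integral_real[OF assms(1)]
  have "(\<lambda>s. s powr (z - 1) / exp s) integrable_on {A..A+1}"
    by (rule integrable_on_subinterval[OF has_integral_integrable[OF 2]]) (use assms in auto)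
  then have 3: "((\<lambda>s. s powr (z - 1) / exp s) has_integral
      integral {A..A+1} (\<lambda>s. s powr (z - 1) / exp s)) {A..A+1}"
    by (rule integrable_integral)
  have "integral {A..A+1} (\<lambda>s. s powr (z - 1) / exp s) \<le> Gamma z"
    by (rule has_integral_subset_le[OF _ 3 2]) (use assms in auto)
  moreover have "A powr z * (exp (- (A + 1)) / (A + 1)) \<le> integral {A..A+1} (\<lambda>s. s powr (z - 1) / exp s)"
  proof (rule has_integral_le[OF 1 3])
    fix s assume s: "s \<in> {A..A+1}"
    have "A powr z * exp (- (A + 1)) / (A + 1) \<le> s powr z * exp (- s) / s"
      by (intro frac_le mult_mono powr_mono2) (use s assms in auto)
    also have "\<dots> = s powr (z - 1) / exp s"
      using s assms by (simp add: powr_diff exp_minus field_simps)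
    finally show "A powr z * (exp (- (A + 1)) / (A + 1)) \<le> s powr (z - 1) / exp s"
      by simp
  qed
  ultimately show ?thesis by linarith
qed

lemma summable_power_over_Gamma:
  fixes x \<alpha> \<gamma> :: real
  assumes "0 < \<alpha>" "0 < \<gamma>" "0 \<le> x"
  shows "summable (\<lambda>r. x ^ r / Gamma (\<alpha> * real r + \<gamma>))"
proof -
  \<comment> \<open>This choice makes \<open>Gamma (\<alpha> r + \<gamma>)\<close> grow at least like \<open>(2x + 1)\<^sup>r\<close>, which beats \<open>x\<^sup>r\<close>.\<close>
  define A where "A = (2 * x + 1) powr (1 / \<alpha>)"
  define \<kappa> where "\<kappa> = A powr \<gamma> * (exp (- (A + 1)) / (A + 1))"
  have A: "1 \<le> A" "A powr \<alpha> = 2 * x + 1"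
    using assms by (auto simp: A_def powr_powr intro!: ge_one_powr_ge_zero)
  have \<kappa>: "0 < \<kappa>" using A by (simp add: \<kappa>_def)
  have "norm (x ^ r / Gamma (\<alpha> * real r + \<gamma>)) \<le> (1/2) ^ r / \<kappa>" for r
  proof -
    have z: "0 < \<alpha> * real r + \<gamma>" using assms by (simp add: add_nonneg_pos)
    have "(2 * x + 1) ^ r * \<kappa> = A powr (\<alpha> * real r + \<gamma>) * (exp (- (A + 1)) / (A + 1))"
      using A assms(3) by (simp add: \<kappa>_def powr_add powr_powr[symmetric] powr_realpow)
    also have "\<dots> \<le> Gamma (\<alpha> * real r + \<gamma>)"
      by (rule Gamma_real_ge_powr[OF z A(1)])
    finally have G: "(2 * x + 1) ^ r * \<kappa> \<le> Gamma (\<alpha> * real r + \<gamma>)" .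
    have "x ^ r / Gamma (\<alpha> * real r + \<gamma>) \<le> ((2 * x + 1) / 2) ^ r / ((2 * x + 1) ^ r * \<kappa>)"
      using assms \<kappa> G by (intro frac_le power_mono) auto
    also have "\<dots> = (1/2) ^ r / \<kappa>" using assms by (simp add: field_simps)
    finally show ?thesis using assms Gamma_real_pos[OF z] by simp
  qed
  moreover have "summable (\<lambda>r. (1/2) ^ r / \<kappa>)"
    by (rule summable_divide) (rule summable_geometric, simp)
  ultimately show ?thesis
    by (rule summable_comparison_test'[where N = 0, rotated])
qed

text \<open>The binomial factor \<open>\<delta> (\<delta> + 1) \<dots> (\<delta> + r - 1) / r!\<close> in the series of the three-parameter
  Mittag-Leffler function. For \<open>\<delta> = 1\<close> it is \<open>1\<close> and for \<open>\<delta> = 2\<close> it is \<open>r + 1\<close>.\<close>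

definition ml_coeff :: "real \<Rightarrow> nat \<Rightarrow> real" where
  "ml_coeff \<delta> r = Gamma (\<delta> + real r) / (fact r * Gamma \<delta>)"

lemma ml_coeff_1: "ml_coeff 1 r = 1"
  using Gamma_fact[of r, where 'a=real] by (simp add: ml_coeff_def add.commute)

lemma ml_coeff_2: "ml_coeff 2 r = real r + 1"
  using Gamma_fact[of "Suc r", where 'a=real] Gamma_fact[of 1, where 'a=real]
  by (simp add: ml_coeff_def add.commute field_simps)

lemma ml_coeff_bounds:
  assumes "0 < \<delta>"
  shows "0 \<le> ml_coeff \<delta> r" "ml_coeff \<delta> r \<le> (\<delta> + 1) ^ r"
proof -
  have "0 \<le> ml_coeff \<delta> r \<and> ml_coeff \<delta> r \<le> (\<delta> + 1) ^ r"
  proof (induction r)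
    case 0
    then show ?case using assms Gamma_real_pos[OF assms] by (simp add: ml_coeff_def)
  next
    case (Suc r)
    have "\<delta> + real r \<noteq> 0" using assms by simp
    then have "ml_coeff \<delta> (Suc r) = ml_coeff \<delta> r * ((\<delta> + real r) / (real r + 1))"
      using Gamma_plus1[of "\<delta> + real r"] assms
      by (auto simp: ml_coeff_def add_ac nonpos_Ints_def field_simps)
    moreover have "(\<delta> + real r) / (real r + 1) \<le> \<delta> + 1"
      using assms by (simp add: field_simps)
    moreover have "0 \<le> (\<delta> + real r) / (real r + 1)" using assms by simp
    ultimately show ?case
      using Suc mult_mono[of "ml_coeff \<delta> r" "(\<delta>+1)^r" "(\<delta> + real r) / (real r + 1)" "\<delta> + 1"] assms
      by (simp add: mult.commute)
  qed
  then show "0 \<le> ml_coeff \<delta> r" "ml_coeff \<delta> r \<le> (\<delta> + 1) ^ r" by auto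
qed

lemma summable_norm_mittag_leffler3:
  assumes "0 < \<delta>" "0 < \<alpha>" "0 < \<gamma>"
  shows "summable (\<lambda>r. norm (ml_coeff \<delta> r * w ^ r / Gamma (\<alpha> * real r + \<gamma>)))"
proof (rule summable_comparison_test'[where N = 0])
  show "summable (\<lambda>r. ((\<delta> + 1) * \<bar>w\<bar>) ^ r / Gamma (\<alpha> * real r + \<gamma>))"
    using assms by (intro summable_power_over_Gamma) auto
  fix r
  have z: "0 < \<alpha> * real r + \<gamma>" using assms by (simp add: add_nonneg_pos)
  show "norm (norm (ml_coeff \<delta> r * w ^ r / Gamma (\<alpha> * real r + \<gamma>)))
      \<le> ((\<delta> + 1) * \<bar>w\<bar>) ^ r / Gamma (\<alpha> * real r + \<gamma>)"
    using ml_coeff_bounds[OF assms(1), of r] Gamma_real_pos[OF z]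
    by (auto simp: abs_mult power_abs power_mult_distrib intro!: divide_right_mono mult_right_mono)
qed

lemma sums_mittag_leffler3:
  assumes "0 < \<delta>" "0 < \<alpha>" "0 < \<gamma>"
  shows "(\<lambda>r. ml_coeff \<delta> r * w ^ r / Gamma (\<alpha> * real r + \<gamma>)) sums mittag_leffler3 \<delta> \<alpha> \<gamma> w"
proof -
  have "mittag_leffler3 \<delta> \<alpha> \<gamma> w = (\<Sum>r. ml_coeff \<delta> r * w ^ r / Gamma (\<alpha> * real r + \<gamma>))"
    unfolding mittag_leffler3_def ml_coeff_def by (simp add: field_simps)
  then show ?thesis
    using summable_sums[OF summable_norm_cancel[OF summable_norm_mittag_leffler3[OF assms]]]
    by simp
qed

lemma mittag_leffler3_1_recurrence:
  fixes \<alpha> w :: real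
  assumes "0 < \<alpha>"
  shows "w * mittag_leffler3 1 \<alpha> (\<alpha> + 1) w = mittag_leffler3 1 \<alpha> 1 w - 1"
proof -
  have "(\<lambda>r. w ^ Suc r / Gamma (\<alpha> * real (Suc r) + 1)) sums (mittag_leffler3 1 \<alpha> 1 w - 1)"
    using sums_mittag_leffler3[of 1 \<alpha> 1 w] assms
    by (subst sums_Suc_iff) (simp add: ml_coeff_1)
  moreover have "(\<lambda>r. w * (w ^ r / Gamma (\<alpha> * real r + (\<alpha> + 1)))) sums
      (w * mittag_leffler3 1 \<alpha> (\<alpha> + 1) w)"
    using sums_mittag_leffler3[of 1 \<alpha> "\<alpha> + 1" w] assms by (intro sums_mult) (simp add: ml_coeff_1)
  ultimately show ?thesis
    by (auto simp: algebra_simps dest: sums_unique2)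
qed

section \<open>Riemann-Liouville integrals\<close>

text \<open>The fractional integral \<open>J\<^sup>a f\<close> of order \<open>a > 0\<close> with base point \<open>0\<close>. Functions need only be
  meaningful on \<open>(0, t)\<close>.\<close>

definition rl_integral :: "real \<Rightarrow> (real \<Rightarrow> real) \<Rightarrow> real \<Rightarrow> real" where
  "rl_integral a f t =
     (LINT s|lborel. indicator {0<..<t} s * ((t - s) powr (a - 1) / Gamma a * f s))"

text \<open>Borel functions that are bounded on every interval \<open>(0, T]\<close>: a class that contains the
  moments of the queue up to order two and is closed under fractional integration.\<close>

definition locally_bounded :: "(real \<Rightarrow> real) \<Rightarrow> bool" where
  "locally_bounded f \<longleftrightarrow>
     f \<in> borel_measurable borel \<and> (\<forall>T>0. \<exists>B. \<forall>s\<in>{0<..T}. \<bar>f s\<bar> \<le> B)"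

lemma locally_boundedD:
  assumes "locally_bounded f"
  shows "f \<in> borel_measurable borel"
    and "0 < T \<Longrightarrow> (\<And>B. 0 \<le> B \<Longrightarrow> (\<And>s. 0 < s \<Longrightarrow> s \<le> T \<Longrightarrow> \<bar>f s\<bar> \<le> B) \<Longrightarrow> thesis) \<Longrightarrow> thesis"
proof -
  show "f \<in> borel_measurable borel" using assms by (simp add: locally_bounded_def)
  assume T: "0 < T" and *: "\<And>B. 0 \<le> B \<Longrightarrow> (\<And>s. 0 < s \<Longrightarrow> s \<le> T \<Longrightarrow> \<bar>f s\<bar> \<le> B) \<Longrightarrow> thesis"
  obtain B where B: "\<forall>s\<in>{0<..T}. \<bar>f s\<bar> \<le> B" using assms T by (auto simp: locally_bounded_def)
  have "0 \<le> B" using B T by (meson abs_ge_zero greaterThanAtMost_iff order_refl order_trans)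
  then show thesis using B by (intro *) auto
qed

lemma locally_boundedI:
  assumes "f \<in> borel_measurable borel" "\<And>T. 0 < T \<Longrightarrow> \<exists>B. \<forall>s\<in>{0<..T}. \<bar>f s\<bar> \<le> B"
  shows "locally_bounded f"
  using assms by (simp add: locally_bounded_def)

lemma locally_bounded_const: "locally_bounded (\<lambda>_. c)"
  by (auto simp: locally_bounded_def)

lemma locally_bounded_add:
  assumes "locally_bounded f" "locally_bounded g"
  shows "locally_bounded (\<lambda>s. f s + g s)"
proof (rule locally_boundedI)
  show "(\<lambda>s. f s + g s) \<in> borel_measurable borel"
    using assms[THEN locally_boundedD(1)] by simp
  fix T :: real assume T: "0 < T"
  obtain B where B: "\<And>s. 0 < s \<Longrightarrow> s \<le> T \<Longrightarrow> \<bar>f s\<bar> \<le> B"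
    using locally_boundedD(2)[OF assms(1) T] by blast
  obtain C where C: "\<And>s. 0 < s \<Longrightarrow> s \<le> T \<Longrightarrow> \<bar>g s\<bar> \<le> C"
    using locally_boundedD(2)[OF assms(2) T] by blast
  have "\<bar>f s + g s\<bar> \<le> B + C" if "s \<in> {0<..T}" for s
    using B[of s] C[of s] that by auto
  then show "\<exists>B. \<forall>s\<in>{0<..T}. \<bar>f s + g s\<bar> \<le> B" by blast
qed

lemma locally_bounded_cmult:
  assumes "locally_bounded f"
  shows "locally_bounded (\<lambda>s. c * f s)"
proof (rule locally_boundedI)
  show "(\<lambda>s. c * f s) \<in> borel_measurable borel"
    using assms[THEN locally_boundedD(1)] by simp
  fix T :: real assume T: "0 < T"
  obtain B where B: "\<And>s. 0 < s \<Longrightarrow> s \<le> T \<Longrightarrow> \<bar>f s\<bar> \<le> B"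
    using locally_boundedD(2)[OF assms(1) T] by blast
  have "\<bar>c * f s\<bar> \<le> \<bar>c\<bar> * B" if "s \<in> {0<..T}" for s
    using B[of s] that by (auto simp: abs_mult intro: mult_left_mono)
  then show "\<exists>B. \<forall>s\<in>{0<..T}. \<bar>c * f s\<bar> \<le> B" by blast
qed

text \<open>The Beta integral, transported from \<open>(0, 1)\<close> to \<open>(s, t)\<close>.\<close>

lemma has_bochner_integral_Beta:
  fixes s t a b :: real
  assumes "s < t" "0 < a" "0 < b"
  shows "has_bochner_integral lborel
    (\<lambda>u. indicator {s<..<t} u * ((t - u) powr (a - 1) * (u - s) powr (b - 1)))
    (Beta a b * (t - s) powr (a + b - 1))"
proof -
  have 0: "set_integrable lborel {0..1} (\<lambda>v::real. v powr (b - 1) * (1 - v) powr (a - 1))"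
    by (rule integrable_Beta) (use assms in auto)
  have "(LINT v:{0..1}|lborel. v powr (b - 1) * (1 - v) powr (a - 1)) = Beta b a"
    using has_integral_Beta_real[of b a] set_borel_integral_eq_integral(2)[OF 0] assms
    by (simp add: integral_unique)
  with 0 have "has_bochner_integral lborel
      (\<lambda>v. indicator {0..1} v *\<^sub>R (v powr (b - 1) * (1 - v) powr (a - 1))) (Beta b a)"
    by (simp add: has_bochner_integral_iff set_integrable_def set_lebesgue_integral_def)
  also have "(\<lambda>v::real. indicator {0..1} v *\<^sub>R (v powr (b - 1) * (1 - v) powr (a - 1)))
      = (\<lambda>v. indicator {0<..<1} v * (v powr (b - 1) * (1 - v) powr (a - 1)))"
    by (auto simp: indicator_def fun_eq_iff)
  finally have "has_bochner_integral lborel (\<lambda>v. (t - s) powr (a + b - 2) *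
      (indicator {0<..<1} v * (v powr (b - 1) * (1 - v) powr (a - 1))))
      ((t - s) powr (a + b - 2) * Beta b a)"
    by (rule has_bochner_integral_mult_right)
  also have "(\<lambda>v. (t - s) powr (a + b - 2) *
      (indicator {0<..<1} v * (v powr (b - 1) * (1 - v) powr (a - 1)))) =
      (\<lambda>v. indicator {s<..<t} (s + (t - s) * v) *
         ((t - (s + (t - s) * v)) powr (a - 1) * (s + (t - s) * v - s) powr (b - 1)))"
  proof
    fix v :: real
    show "(t - s) powr (a + b - 2) *
      (indicator {0<..<1} v * (v powr (b - 1) * (1 - v) powr (a - 1))) =
      indicator {s<..<t} (s + (t - s) * v) *
         ((t - (s + (t - s) * v)) powr (a - 1) * (s + (t - s) * v - s) powr (b - 1))"
    proof (cases "0 < v \<and> v < 1")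
      case True
      have *: "s + (t - s) * v < t" proof -
        have "(t - s) * v < (t - s) * 1" using True assms by (intro mult_strict_left_mono) auto
        then show ?thesis by simp
      qed
      have **: "t - (s + (t - s) * v) = (t - s) * (1 - v)" by (simp add: algebra_simps)
      have ***: "a + b - 2 = (a - 1) + (b - 1)" by simp
      show ?thesis
        unfolding ** *** powr_add using True assms *
        by (simp add: powr_mult)
    next
      case False
      have "t - s \<le> (t - s) * v" if "1 \<le> v"
        using mult_left_mono[OF that, of "t - s"] assms by simp
      moreover have "(t - s) * v \<le> 0" if "v \<le> 0"
        using that assms by (simp add: mult_nonneg_nonpos)
      ultimately have "s + (t - s) * v \<notin> {s<..<t}"
        using False by (cases "1 \<le> v") auto
      then have "indicator {s<..<t} (s + (t - s) * v) = (0::real)"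
        by simp
      then show ?thesis using False by (auto simp: indicator_def)
    qed
  qed
  also have "(t - s) powr (a + b - 2) * Beta b a = (Beta a b * (t - s) powr (a + b - 1)) /\<^sub>R \<bar>t - s\<bar>"
  proof -
    have "a + b - 1 = (a + b - 2) + 1" by simp
    then have "(t - s) powr (a + b - 1) = (t - s) powr (a + b - 2) * (t - s)"
      using assms by (metis powr_add powr_one less_eq_real_def diff_gt_0_iff_gt)
    then show ?thesis using assms by (simp add: Beta_commute[of b a] divide_inverse)
  qed
  finally show ?thesis
    using assms by (subst lborel_has_bochner_integral_real_affine_iff[where c = "t - s" and t = s]) auto
qed

lemma has_bochner_integral_rl_kernel:
  fixes a t :: real
  assumes "0 < t" "0 < a"
  shows "has_bochner_integral lborel
    (\<lambda>s. indicator {0<..<t} s * ((t - s) powr (a - 1) / Gamma a)) (t powr a / Gamma (a + 1))"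
proof -
  have G: "Gamma (a + 1) = a * Gamma a" "0 < Gamma a"
    using assms(2) by (auto intro!: Gamma_plus1 simp: nonpos_Ints_def)
  have B: "Beta a 1 = 1 / a"
    using G by (simp add: Beta_def)
  have "has_bochner_integral lborel
    (\<lambda>u. indicator {0<..<t} u * ((t - u) powr (a - 1) * (u - 0) powr (1 - 1)) / Gamma a)
    (Beta a 1 * (t - 0) powr (a + 1 - 1) / Gamma a)"
    using has_bochner_integral_Beta[of 0 t a 1] assms
    by (intro has_bochner_integral_divide_zero) auto
  also have "(\<lambda>u. indicator {0<..<t} u * ((t - u) powr (a - 1) * (u - 0) powr (1 - 1)) / Gamma a)
     = (\<lambda>s. indicator {0<..<t} s * ((t - s) powr (a - 1) / Gamma a))"
    by (auto simp: indicator_def)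
  also have "Beta a 1 * (t - 0) powr (a + 1 - 1) / Gamma a = t powr a / Gamma (a + 1)"
    using assms G by (simp add: B)
  finally show ?thesis .
qed

lemma integrable_rl_integrand:
  assumes "locally_bounded f" "0 < t" "0 < a"
  shows "integrable lborel (\<lambda>s. indicator {0<..<t} s * ((t - s) powr (a - 1) / Gamma a * f s))"
proof -
  obtain B where B: "0 \<le> B" "\<And>s. 0 < s \<Longrightarrow> s \<le> t \<Longrightarrow> \<bar>f s\<bar> \<le> B"
    using locally_boundedD(2)[OF assms(1,2)] by blast
  note [measurable] = locally_boundedD(1)[OF assms(1)]
  show ?thesis
  proof (rule Bochner_Integration.integrable_bound)
    show "integrable lborel (\<lambda>s. B * (indicator {0<..<t} s * ((t - s) powr (a - 1) / Gamma a)))"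
      using has_bochner_integral_mult_right[OF has_bochner_integral_rl_kernel[OF assms(2,3)]]
      by (rule has_bochner_integral_iff[THEN iffD1, THEN conjunct1])
    show "AE s in lborel. norm (indicator {0<..<t} s * ((t - s) powr (a - 1) / Gamma a * f s))
        \<le> norm (B * (indicator {0<..<t} s * ((t - s) powr (a - 1) / Gamma a)))"
    proof (rule AE_I2)
      fix s
      show "norm (indicator {0<..<t} s * ((t - s) powr (a - 1) / Gamma a * f s))
        \<le> norm (B * (indicator {0<..<t} s * ((t - s) powr (a - 1) / Gamma a)))"
      proof (cases "0 < s \<and> s < t")
        case True
        then have "((t - s) powr (a - 1) / Gamma a) * \<bar>f s\<bar> \<le> ((t - s) powr (a - 1) / Gamma a) * B"
          using B(2)[of s] Gamma_real_pos[OF assms(3)] by (intro mult_left_mono) auto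
        then show ?thesis
          using True B(1) Gamma_real_pos[OF assms(3)] by (simp add: abs_mult mult.commute)
      qed auto
    qed
  qed measurable
qed

lemma rl_integral_const:
  assumes "0 < t" "0 < a"
  shows "rl_integral a (\<lambda>_. c) t = c * (t powr a / Gamma (a + 1))"
proof -
  have "has_bochner_integral lborel
    (\<lambda>s. indicator {0<..<t} s * ((t - s) powr (a - 1) / Gamma a) * c) (t powr a / Gamma (a + 1) * c)"
    by (intro has_bochner_integral_mult_left has_bochner_integral_rl_kernel assms)
  then show ?thesis
    by (simp add: rl_integral_def has_bochner_integral_iff mult_ac)
qed

lemma rl_integral_add:
  assumes "locally_bounded f" "locally_bounded g" "0 < t" "0 < a"
  shows "rl_integral a (\<lambda>s. f s + g s) t = rl_integral a f t + rl_integral a g t"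
  using integrable_rl_integrand[OF assms(1,3,4)] integrable_rl_integrand[OF assms(2,3,4)]
  by (simp add: rl_integral_def distrib_left)

lemma rl_integral_cmult: "rl_integral a (\<lambda>s. c * f s) t = c * rl_integral a f t"
proof -
  have "(\<lambda>s. indicator {0<..<t} s * ((t - s) powr (a - 1) / Gamma a * (c * f s)))
      = (\<lambda>s. c * (indicator {0<..<t} s * ((t - s) powr (a - 1) / Gamma a * f s)))"
    by auto
  then show ?thesis unfolding rl_integral_def by simp
qed

lemma rl_integral_cong:
  assumes "\<And>s. 0 < s \<Longrightarrow> s < t \<Longrightarrow> f s = g s"
  shows "rl_integral a f t = rl_integral a g t"
  unfolding rl_integral_def using assms
  by (intro Bochner_Integration.integral_cong) (auto simp: indicator_def)

lemma rl_integral_mono: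
  assumes "locally_bounded f" "locally_bounded g" "0 < t" "0 < a"
    and "\<And>s. 0 < s \<Longrightarrow> s < t \<Longrightarrow> f s \<le> g s"
  shows "rl_integral a f t \<le> rl_integral a g t"
  unfolding rl_integral_def
  using assms(5) Gamma_real_pos[OF assms(4)]
  by (intro integral_mono integrable_rl_integrand assms)
     (auto simp: indicator_def intro!: mult_left_mono divide_right_mono)

lemma rl_integral_abs_le:
  assumes "locally_bounded f" "0 < t" "0 < a"
    and "\<And>s. 0 < s \<Longrightarrow> s < t \<Longrightarrow> \<bar>f s\<bar> \<le> B"
  shows "\<bar>rl_integral a f t\<bar> \<le> B * (t powr a / Gamma (a + 1))"
proof -
  have "rl_integral a f t \<le> rl_integral a (\<lambda>_. B) t"
    by (rule rl_integral_mono) (use assms in \<open>force simp: locally_bounded_const abs_le_iff\<close>)+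
  moreover have "rl_integral a (\<lambda>_. - B) t \<le> rl_integral a f t"
    by (rule rl_integral_mono) (use assms in \<open>force simp: locally_bounded_const abs_le_iff\<close>)+
  ultimately show ?thesis
    using assms by (simp add: rl_integral_const)
qed

lemma borel_measurable_rl_integral:
  assumes [measurable]: "f \<in> borel_measurable borel"
  shows "rl_integral a f \<in> borel_measurable borel"
proof -
  have "(\<lambda>t. LINT s|lborel. (case (t, s) of (t, s) \<Rightarrow>
      (if 0 < s \<and> s < t then 1 else 0) * ((t - s) powr (a - 1) / Gamma a * f s))) \<in> borel_measurable borel"
    by (rule lborel.borel_measurable_lebesgue_integral) (simp add: split_beta')
  then show ?thesis
  proof (rule back_subst[where P = "\<lambda>h. h \<in> borel_measurable borel"])
    show "(\<lambda>t. LINT s|lborel. (case (t, s) of (t, s) \<Rightarrow>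
      (if 0 < s \<and> s < t then 1 else 0) * ((t - s) powr (a - 1) / Gamma a * f s))) = rl_integral a f"
      unfolding rl_integral_def
      by (intro ext Bochner_Integration.integral_cong) (auto simp: indicator_def)
  qed
qed

lemma locally_bounded_rl_integral:
  assumes "locally_bounded f" "0 < a"
  shows "locally_bounded (rl_integral a f)"
proof (rule locally_boundedI)
  show "rl_integral a f \<in> borel_measurable borel"
    by (rule borel_measurable_rl_integral[OF locally_boundedD(1)[OF assms(1)]])
  fix T :: real assume T: "0 < T"
  obtain B where B: "0 \<le> B" "\<And>s. 0 < s \<Longrightarrow> s \<le> T \<Longrightarrow> \<bar>f s\<bar> \<le> B"
    using locally_boundedD(2)[OF assms(1) T] by blast
  have "\<bar>rl_integral a f t\<bar> \<le> B * (T powr a / Gamma (a + 1))" if "t \<in> {0<..T}" for t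
  proof -
    have "\<bar>rl_integral a f t\<bar> \<le> B * (t powr a / Gamma (a + 1))"
      using that by (intro rl_integral_abs_le assms B(2)) auto
    also have "\<dots> \<le> B * (T powr a / Gamma (a + 1))"
      using that assms(2) B(1) Gamma_real_pos[of "a + 1"]
      by (intro mult_left_mono divide_right_mono powr_mono2) auto
    finally show ?thesis .
  qed
  then show "\<exists>B. \<forall>s\<in>{0<..T}. \<bar>rl_integral a f s\<bar> \<le> B" by blast
qed

text \<open>The semigroup law \<open>J\<^sup>a J\<^sup>b = J\<^bsup>a+b\<^esup>\<close>, by Fubini and the Beta integral. It is
  needed also for the derivative of a Caputo differentiable function, which may be unbounded; hence
  the only requirement is that the right-hand side converges absolutely at \<open>t\<close>.\<close>

lemma rl_integral_semigroup_gen: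
  assumes [measurable]: "f \<in> borel_measurable borel" and "0 < t" "0 < a" "0 < b"
    and int: "integrable lborel (\<lambda>s. indicator {0<..<t} s * ((t - s) powr (a + b - 1) * f s))"
  shows "rl_integral a (rl_integral b f) t = rl_integral (a + b) f t"
proof -
  \<comment> \<open>The kernel of the iterated integral; its support condition carries both domains of integration.\<close>
  define k where "k s u = (if 0 < s \<and> s < u \<and> u < t
    then (t - u) powr (a - 1) / Gamma a * ((u - s) powr (b - 1) / Gamma b) else 0)" for s u :: real
  have [measurable]: "case_prod k \<in> borel_measurable (borel \<Otimes>\<^sub>M borel)"
    unfolding k_def split_beta' by measurable
  have G: "0 < Gamma a" "0 < Gamma b" "0 < Gamma (a + b)" using assms by auto
  have k_nonneg: "0 \<le> k s u" for s u using G by (simp add: k_def)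
  have k_int: "has_bochner_integral lborel (k s)
      (indicator {0<..<t} s * ((t - s) powr (a + b - 1) / Gamma (a + b)))" for s
  proof (cases "0 < s \<and> s < t")
    case True
    have "has_bochner_integral lborel
        (\<lambda>u. indicator {s<..<t} u * ((t - u) powr (a - 1) * (u - s) powr (b - 1)) * (1 / (Gamma a * Gamma b)))
        (Beta a b * (t - s) powr (a + b - 1) * (1 / (Gamma a * Gamma b)))"
      by (intro has_bochner_integral_mult_left has_bochner_integral_Beta) (use True assms in auto)
    also have "(\<lambda>u. indicator {s<..<t} u * ((t - u) powr (a - 1) * (u - s) powr (b - 1)) * (1 / (Gamma a * Gamma b))) = k s"
      using True by (auto simp: k_def indicator_def)
    also have "Beta a b * (t - s) powr (a + b - 1) * (1 / (Gamma a * Gamma b)) =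
        indicator {0<..<t} s * ((t - s) powr (a + b - 1) / Gamma (a + b))"
      using True G by (simp add: Beta_def)
    finally show ?thesis .
  next
    case False
    then have "k s = (\<lambda>u. 0)" by (auto simp: k_def)
    then show ?thesis using False by (auto simp: indicator_def has_bochner_integral_zero)
  qed
  have int2: "integrable lborel (\<lambda>s. indicator {0<..<t} s * ((t - s) powr (a + b - 1) / Gamma (a + b)) * f s)"
  proof -
    have "integrable lborel (\<lambda>s. indicator {0<..<t} s * ((t - s) powr (a + b - 1) * f s) * (1 / Gamma (a + b)))"
      using int by (rule integrable_mult_left)
    then show ?thesis by (rule Bochner_Integration.integrable_cong[THEN iffD1, rotated 2]) auto
  qed
  have "integrable (lborel \<Otimes>\<^sub>M lborel) (\<lambda>(s, u). k s u * f s)"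
  proof (rule lborel_pair.Fubini_integrable)
    show "(\<lambda>(s, u). k s u * f s) \<in> borel_measurable (lborel \<Otimes>\<^sub>M lborel)"
      by measurable
    have "(\<integral>u. norm (case (s, u) of (s, u) \<Rightarrow> k s u * f s) \<partial>lborel) =
        norm (indicator {0<..<t} s * ((t - s) powr (a + b - 1) / Gamma (a + b)) * f s)" for s
    proof -
      have "(\<integral>u. norm (case (s, u) of (s, u) \<Rightarrow> k s u * f s) \<partial>lborel) = (\<integral>u. k s u * \<bar>f s\<bar> \<partial>lborel)"
        using k_nonneg by (simp add: abs_mult)
      also have "\<dots> = indicator {0<..<t} s * ((t - s) powr (a + b - 1) / Gamma (a + b)) * \<bar>f s\<bar>"
        using has_bochner_integral_integral_eq[OF k_int[of s]] by simp
      finally show ?thesis using G by (simp add: abs_mult)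
    qed
    then show "integrable lborel (\<lambda>s. \<integral>u. norm (case (s, u) of (s, u) \<Rightarrow> k s u * f s) \<partial>lborel)"
      using integrable_norm[OF int2] by simp
    show "AE s in lborel. integrable lborel (\<lambda>u. case (s, u) of (s, u) \<Rightarrow> k s u * f s)"
      using k_int by (auto simp: has_bochner_integral_iff)
  qed
  note F = lborel_pair.Fubini_integral[OF this]
  have "rl_integral a (rl_integral b f) t = (\<integral>u. (\<integral>s. k s u * f s \<partial>lborel) \<partial>lborel)"
    unfolding rl_integral_def
  proof (rule Bochner_Integration.integral_cong[OF refl])
    fix u :: real
    have "indicator {0<..<t} u * ((t - u) powr (a - 1) / Gamma a *
        (LINT s|lborel. indicator {0<..<u} s * ((u - s) powr (b - 1) / Gamma b * f s))) =
        (LINT s|lborel. indicator {0<..<t} u * ((t - u) powr (a - 1) / Gamma a) * (indicator {0<..<u} s * ((u - s) powr (b - 1) / Gamma b * f s)))"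
      by simp
    also have "\<dots> = (\<integral>s. k s u * f s \<partial>lborel)"
      by (rule Bochner_Integration.integral_cong) (auto simp: k_def indicator_def)
    finally show "indicator {0<..<t} u * ((t - u) powr (a - 1) / Gamma a *
        (LINT s|lborel. indicator {0<..<u} s * ((u - s) powr (b - 1) / Gamma b * f s))) =
        (\<integral>s. k s u * f s \<partial>lborel)" .
  qed
  also have "\<dots> = (\<integral>s. (\<integral>u. k s u * f s \<partial>lborel) \<partial>lborel)"
    using F by simp
  also have "\<dots> = rl_integral (a + b) f t"
    unfolding rl_integral_def using has_bochner_integral_integral_eq[OF k_int]
    by (intro Bochner_Integration.integral_cong) auto
  finally show ?thesis .
qed

lemma rl_integral_semigroup:
  assumes "locally_bounded f" "0 < t" "0 < a" "0 < b"
  shows "rl_integral a (rl_integral b f) t = rl_integral (a + b) f t"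
proof (rule rl_integral_semigroup_gen)
  show "f \<in> borel_measurable borel" using locally_boundedD(1)[OF assms(1)] .
  have "integrable lborel (\<lambda>s. indicator {0<..<t} s * ((t - s) powr (a + b - 1) / Gamma (a + b) * f s) * Gamma (a + b))"
    using assms by (intro integrable_mult_left integrable_rl_integrand) auto
  moreover have "Gamma (a + b) \<noteq> 0"
    using Gamma_real_pos[OF add_pos_pos[OF assms(3,4)]] by simp
  ultimately show "integrable lborel (\<lambda>s. indicator {0<..<t} s * ((t - s) powr (a + b - 1) * f s))"
    by simp
qed (use assms in auto)

lemma rl_integral_dominated_convergence:
  assumes f: "\<And>n. locally_bounded (f n)" and g: "locally_bounded g" and pos: "0 < t" "0 < a"
    and bound: "\<And>n s. 0 < s \<Longrightarrow> s < t \<Longrightarrow> \<bar>f n s\<bar> \<le> B"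
    and lim: "\<And>s. 0 < s \<Longrightarrow> s < t \<Longrightarrow> (\<lambda>n. f n s) \<longlonglongrightarrow> g s"
  shows "(\<lambda>n. rl_integral a (f n) t) \<longlonglongrightarrow> rl_integral a g t"
  unfolding rl_integral_def
proof (rule integral_dominated_convergence
    [where w = "\<lambda>s. indicator {0<..<t} s * ((t - s) powr (a - 1) / Gamma a * B)"])
  note [measurable] = locally_boundedD(1)[OF f] locally_boundedD(1)[OF g]
  show "(\<lambda>s. indicator {0<..<t} s * ((t - s) powr (a - 1) / Gamma a * g s)) \<in> borel_measurable lborel"
    by measurable
  show "(\<lambda>s. indicator {0<..<t} s * ((t - s) powr (a - 1) / Gamma a * f n s)) \<in> borel_measurable lborel" for n
    by measurable
  show "integrable lborel (\<lambda>s. indicator {0<..<t} s * ((t - s) powr (a - 1) / Gamma a * B))"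
    by (intro integrable_rl_integrand locally_bounded_const pos)
  have "(\<lambda>n. indicator {0<..<t} s * ((t - s) powr (a - 1) / Gamma a * f n s)) \<longlonglongrightarrow>
      indicator {0<..<t} s * ((t - s) powr (a - 1) / Gamma a * g s)" for s
    by (cases "0 < s \<and> s < t") (intro tendsto_mult_left lim, auto)
  then show "AE s in lborel. (\<lambda>n. indicator {0<..<t} s * ((t - s) powr (a - 1) / Gamma a * f n s)) \<longlonglongrightarrow>
      indicator {0<..<t} s * ((t - s) powr (a - 1) / Gamma a * g s)"
    by simp
  have "norm (indicator {0<..<t} s * ((t - s) powr (a - 1) / Gamma a * f n s))
      \<le> indicator {0<..<t} s * ((t - s) powr (a - 1) / Gamma a * B)" for n s
  proof (cases "0 < s \<and> s < t")
    case True
    then have "(t - s) powr (a - 1) / Gamma a * \<bar>f n s\<bar> \<le> (t - s) powr (a - 1) / Gamma a * B"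
      using bound[of s n] Gamma_real_pos[OF pos(2)] by (intro mult_left_mono) auto
    then show ?thesis using True Gamma_real_pos[OF pos(2)] by (simp add: abs_mult)
  qed simp
  then show "AE s in lborel. norm (indicator {0<..<t} s * ((t - s) powr (a - 1) / Gamma a * f n s))
      \<le> indicator {0<..<t} s * ((t - s) powr (a - 1) / Gamma a * B)" for n
    by simp
qed

section \<open>Convolution with Mittag-Leffler kernels\<close>

text \<open>The convolution with \<open>u\<^bsup>\<gamma>-1\<^esup> E\<^sup>\<delta>\<^bsub>\<alpha>,\<gamma>\<^esub>(a u\<^bsup>\<alpha>\<^esup>)\<close>, the kernel that occurs throughout the result.\<close>

definition ml_convolution ::
    "real \<Rightarrow> real \<Rightarrow> real \<Rightarrow> real \<Rightarrow> (real \<Rightarrow> real) \<Rightarrow> real \<Rightarrow> real" where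
  "ml_convolution \<delta> \<alpha> \<gamma> a f t =
     time_convolution f (\<lambda>u. u powr (\<gamma> - 1) * mittag_leffler3 \<delta> \<alpha> \<gamma> (a * u powr \<alpha>)) t"

lemma time_convolution_eq_lborel:
  assumes "0 < t"
  shows "time_convolution f g t = (LINT u|lborel. indicator {0<..<t} u * (f u * g (t - u)))"
  using assms
  by (simp add: time_convolution_def interval_lebesgue_integral_def set_lebesgue_integral_def zero_ereal_def)

lemma time_convolution_cong:
  assumes "0 < t" "\<And>u. 0 < u \<Longrightarrow> u < t \<Longrightarrow> f u = f' u"
  shows "time_convolution f g t = time_convolution f' g t"
  using assms
  by (auto simp: time_convolution_eq_lborel indicator_def intro!: Bochner_Integration.integral_cong)

text \<open>Expanding the Mittag-Leffler kernel termwise turns such a convolution into a series of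
  fractional integrals.\<close>

lemma sums_ml_convolution:
  assumes f: "locally_bounded f" and pos: "0 < t" "0 < \<delta>" "0 < \<alpha>" "0 < \<gamma>"
  shows "(\<lambda>r. ml_coeff \<delta> r * a ^ r * rl_integral (\<alpha> * real r + \<gamma>) f t)
    sums ml_convolution \<delta> \<alpha> \<gamma> a f t"
proof -
  define \<beta> where "\<beta> r = \<alpha> * real r + \<gamma>" for r
  have \<beta>: "0 < \<beta> r" for r using pos by (simp add: \<beta>_def add_nonneg_pos)
  note G = Gamma_real_pos[OF \<beta>]
  define h where "h r s = ml_coeff \<delta> r * a ^ r *
    (indicator {0<..<t} s * ((t - s) powr (\<beta> r - 1) / Gamma (\<beta> r) * f s))" for r s
  have h_eq: "h r s = ml_coeff \<delta> r * (a * (t - s) powr \<alpha>) ^ r / Gamma (\<beta> r) *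
      ((t - s) powr (\<gamma> - 1) * f s)" if "0 < s" "s < t" for r s
  proof -
    have "(t - s) powr (\<beta> r - 1) = (t - s) powr (\<alpha> * real r) * (t - s) powr (\<gamma> - 1)"
      by (simp add: \<beta>_def powr_add[symmetric] algebra_simps)
    also have "(t - s) powr (\<alpha> * real r) = ((t - s) powr \<alpha>) ^ r"
      using that by (simp add: powr_powr[symmetric] powr_realpow)
    finally show ?thesis using that by (simp add: h_def power_mult_distrib)
  qed
  have int: "integrable lborel (h r)" for r
    unfolding h_def using \<beta> by (intro integrable_mult_right integrable_rl_integrand f pos)
  obtain B where B: "0 \<le> B" "\<And>s. 0 < s \<Longrightarrow> s \<le> t \<Longrightarrow> \<bar>f s\<bar> \<le> B"
    using locally_boundedD(2)[OF f pos(1)] by blast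
  have 1: "summable (\<lambda>r. norm (h r s))" for s
  proof (cases "0 < s \<and> s < t")
    case True
    have "summable (\<lambda>r. norm (ml_coeff \<delta> r * (a * (t - s) powr \<alpha>) ^ r / Gamma (\<beta> r)) *
        norm ((t - s) powr (\<gamma> - 1) * f s))"
      unfolding \<beta>_def by (intro summable_mult2 summable_norm_mittag_leffler3 pos)
    then show ?thesis using True by (simp add: h_eq abs_mult)
  next
    case False
    then have "(\<lambda>r. norm (h r s)) = (\<lambda>_. 0)" by (auto simp: h_def)
    then show ?thesis by simp
  qed
  have 2: "summable (\<lambda>r. \<integral>s. norm (h r s) \<partial>lborel)"
  proof (rule summable_comparison_test'[where N = 0])
    show "summable (\<lambda>r. norm (ml_coeff \<delta> r * (a * t powr \<alpha>) ^ r / Gamma (\<alpha> * real r + (\<gamma> + 1)))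
        * (B * t powr \<gamma>))"
      by (intro summable_mult2 summable_norm_mittag_leffler3) (use pos in auto)
    fix r
    have G1: "0 < Gamma (\<beta> r + 1)" using \<beta>[of r] by (intro Gamma_real_pos) simp
    define C where "C = \<bar>ml_coeff \<delta> r * a ^ r\<bar>"
    have "(\<integral>s. norm (h r s) \<partial>lborel) \<le>
        (\<integral>s. C * B * (indicator {0<..<t} s * ((t - s) powr (\<beta> r - 1) / Gamma (\<beta> r))) \<partial>lborel)"
    proof (rule integral_mono)
      show "integrable lborel (\<lambda>s. norm (h r s))" by (rule integrable_norm[OF int])
      show "integrable lborel (\<lambda>s. C * B * (indicator {0<..<t} s * ((t - s) powr (\<beta> r - 1) / Gamma (\<beta> r))))"
        using has_bochner_integral_rl_kernel[OF pos(1) \<beta>[of r]]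
        by (intro integrable_mult_right) (rule has_bochner_integral_iff[THEN iffD1, THEN conjunct1])
      fix s
      show "norm (h r s) \<le> C * B * (indicator {0<..<t} s * ((t - s) powr (\<beta> r - 1) / Gamma (\<beta> r)))"
      proof (cases "0 < s \<and> s < t")
        case True
        have "norm (h r s) = C * ((t - s) powr (\<beta> r - 1) / Gamma (\<beta> r) * \<bar>f s\<bar>)"
          using True G[of r] by (simp add: h_def C_def abs_mult)
        also have "\<dots> \<le> C * ((t - s) powr (\<beta> r - 1) / Gamma (\<beta> r) * B)"
          using True G[of r] B(2)[of s] by (intro mult_left_mono) (auto simp: C_def)
        finally show ?thesis using True by (simp add: mult_ac)
      qed (simp add: h_def)
    qed
    also have "\<dots> = C * B * (t powr \<beta> r / Gamma (\<beta> r + 1))"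
      using has_bochner_integral_integral_eq[OF has_bochner_integral_rl_kernel[OF pos(1) \<beta>[of r]]]
      by (simp only: integral_mult_right_zero)
    also have "t powr \<beta> r = (t powr \<alpha>) ^ r * t powr \<gamma>"
      using pos by (simp add: \<beta>_def powr_add powr_powr[symmetric] powr_realpow)
    also have "C * B * ((t powr \<alpha>) ^ r * t powr \<gamma> / Gamma (\<beta> r + 1)) =
        norm (ml_coeff \<delta> r * (a * t powr \<alpha>) ^ r / Gamma (\<alpha> * real r + (\<gamma> + 1))) * (B * t powr \<gamma>)"
      using G1 by (simp add: C_def \<beta>_def abs_mult power_mult_distrib add.assoc power_abs)
    finally show "norm (\<integral>s. norm (h r s) \<partial>lborel) \<le>
        norm (ml_coeff \<delta> r * (a * t powr \<alpha>) ^ r / Gamma (\<alpha> * real r + (\<gamma> + 1))) * (B * t powr \<gamma>)"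
      by (simp add: integral_nonneg_AE)
  qed
  have "(\<Sum>r. h r s) = indicator {0<..<t} s * (f s * ((t - s) powr (\<gamma> - 1) *
      mittag_leffler3 \<delta> \<alpha> \<gamma> (a * (t - s) powr \<alpha>)))" for s
  proof (cases "0 < s \<and> s < t")
    case True
    have "(\<lambda>r. ml_coeff \<delta> r * (a * (t - s) powr \<alpha>) ^ r / Gamma (\<beta> r) * ((t - s) powr (\<gamma> - 1) * f s)) sums
       (mittag_leffler3 \<delta> \<alpha> \<gamma> (a * (t - s) powr \<alpha>) * ((t - s) powr (\<gamma> - 1) * f s))"
      unfolding \<beta>_def by (intro sums_mult2 sums_mittag_leffler3 pos)
    then have "(\<lambda>r. h r s) sums
       (mittag_leffler3 \<delta> \<alpha> \<gamma> (a * (t - s) powr \<alpha>) * ((t - s) powr (\<gamma> - 1) * f s))"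
      using True by (simp add: h_eq)
    then show ?thesis using True by (simp add: sums_iff mult_ac)
  next
    case False
    then show ?thesis by (simp add: h_def)
  qed
  then have "(\<integral>s. (\<Sum>r. h r s) \<partial>lborel) = ml_convolution \<delta> \<alpha> \<gamma> a f t"
    by (simp add: ml_convolution_def time_convolution_eq_lborel[OF pos(1)])
  moreover have "(\<lambda>r. integral\<^sup>L lborel (h r)) sums (\<integral>s. (\<Sum>r. h r s) \<partial>lborel)"
    by (rule sums_integral) (use int 1 2 in auto)
  moreover have "integral\<^sup>L lborel (h r) = ml_coeff \<delta> r * a ^ r * rl_integral (\<alpha> * real r + \<gamma>) f t" for r
    by (simp add: h_def[abs_def] rl_integral_def \<beta>_def)
  ultimately show ?thesis by simp
qed

lemma sums_power_mittag_leffler3: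
  assumes "0 < t" "0 < \<delta>" "0 < \<alpha>" "0 \<le> \<gamma>"
  shows "(\<lambda>r. ml_coeff \<delta> r * a ^ r * (t powr (\<alpha> * real r + \<gamma>) / Gamma (\<alpha> * real r + \<gamma> + 1)))
    sums (t powr \<gamma> * mittag_leffler3 \<delta> \<alpha> (\<gamma> + 1) (a * t powr \<alpha>))"
proof -
  have "(\<lambda>r. t powr \<gamma> * (ml_coeff \<delta> r * (a * t powr \<alpha>) ^ r / Gamma (\<alpha> * real r + (\<gamma> + 1))))
    sums (t powr \<gamma> * mittag_leffler3 \<delta> \<alpha> (\<gamma> + 1) (a * t powr \<alpha>))"
    using assms by (intro sums_mult sums_mittag_leffler3) auto
  moreover have "t powr (\<alpha> * real r + \<gamma>) = (t powr \<alpha>) ^ r * t powr \<gamma>" for r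
    using assms by (simp add: powr_add powr_powr[symmetric] powr_realpow)
  ultimately show ?thesis
    by (simp add: power_mult_distrib mult_ac add.assoc)
qed

lemma ml_convolution_const:
  assumes "0 < t" "0 < \<delta>" "0 < \<alpha>" "0 < \<gamma>"
  shows "ml_convolution \<delta> \<alpha> \<gamma> a (\<lambda>_. c) t =
    c * (t powr \<gamma> * mittag_leffler3 \<delta> \<alpha> (\<gamma> + 1) (a * t powr \<alpha>))"
proof -
  have z: "0 < \<alpha> * real r + \<gamma>" for r using assms by (simp add: add_nonneg_pos)
  have "(\<lambda>r. c * (ml_coeff \<delta> r * a ^ r * (t powr (\<alpha> * real r + \<gamma>) / Gamma (\<alpha> * real r + \<gamma> + 1)))) sums
    (c * (t powr \<gamma> * mittag_leffler3 \<delta> \<alpha> (\<gamma> + 1) (a * t powr \<alpha>)))"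
    using assms by (intro sums_mult sums_power_mittag_leffler3) auto
  moreover have "(\<lambda>r. c * (ml_coeff \<delta> r * a ^ r * (t powr (\<alpha> * real r + \<gamma>) / Gamma (\<alpha> * real r + \<gamma> + 1)))) sums
    ml_convolution \<delta> \<alpha> \<gamma> a (\<lambda>_. c) t"
    using sums_ml_convolution[OF locally_bounded_const[of c] assms, of a] z
    by (simp add: rl_integral_const[OF assms(1)] mult_ac)
  ultimately show ?thesis by (rule sums_unique2[symmetric])
qed

lemma ml_convolution_add:
  assumes "locally_bounded f" "locally_bounded g" "0 < t" "0 < \<delta>" "0 < \<alpha>" "0 < \<gamma>"
  shows "ml_convolution \<delta> \<alpha> \<gamma> a (\<lambda>s. f s + g s) t =
    ml_convolution \<delta> \<alpha> \<gamma> a f t + ml_convolution \<delta> \<alpha> \<gamma> a g t"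
proof -
  have z: "0 < \<alpha> * real r + \<gamma>" for r using assms by (simp add: add_nonneg_pos)
  show ?thesis
    using sums_ml_convolution[OF locally_bounded_add[OF assms(1,2)] assms(3-6), of a]
      sums_add[OF sums_ml_convolution[OF assms(1,3-6), of a] sums_ml_convolution[OF assms(2,3-6), of a]]
    by (intro sums_unique2) (auto simp: rl_integral_add[OF assms(1-3) z] distrib_left)
qed

lemma ml_convolution_cmult: "ml_convolution \<delta> \<alpha> \<gamma> a (\<lambda>s. c * f s) t = c * ml_convolution \<delta> \<alpha> \<gamma> a f t"
  by (simp add: ml_convolution_def time_convolution_def mult.assoc)

section \<open>Linear fractional Volterra equations\<close>

text \<open>Applying a further fractional integral to \<open>m = c + J\<^bsup>\<alpha>\<^esup>(h + a m)\<close> by the semigroup law.\<close>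

lemma volterra_step:
  assumes m: "locally_bounded m" and h: "locally_bounded h" and "0 < \<alpha>" "0 < b" "0 < t"
    and eq: "\<And>t. 0 < t \<Longrightarrow> m t = c + rl_integral \<alpha> (\<lambda>s. h s + a * m s) t"
  shows "rl_integral b m t = c * (t powr b / Gamma (b + 1)) +
    rl_integral (b + \<alpha>) h t + a * rl_integral (b + \<alpha>) m t"
proof -
  let ?g = "\<lambda>s. h s + a * m s"
  have g: "locally_bounded ?g" by (intro locally_bounded_add locally_bounded_cmult m h)
  have "rl_integral b m t = rl_integral b (\<lambda>s. c + rl_integral \<alpha> ?g s) t"
    by (rule rl_integral_cong) (rule eq)
  also have "\<dots> = rl_integral b (\<lambda>_. c) t + rl_integral b (rl_integral \<alpha> ?g) t"
    using assms by (intro rl_integral_add locally_bounded_const locally_bounded_rl_integral g) auto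
  also have "rl_integral b (rl_integral \<alpha> ?g) t = rl_integral (b + \<alpha>) ?g t"
    using assms by (intro rl_integral_semigroup g) auto
  also have "\<dots> = rl_integral (b + \<alpha>) h t + a * rl_integral (b + \<alpha>) m t"
    using assms by (subst rl_integral_add) (auto intro: locally_bounded_cmult simp: rl_integral_cmult)
  finally show ?thesis using assms by (simp add: rl_integral_const)
qed

text \<open>The partial sums of the Neumann series of \<open>m = c + J\<^bsup>\<alpha>\<^esup>(h + a m)\<close>, with remainder.\<close>

lemma volterra_iterate:
  assumes m: "locally_bounded m" and h: "locally_bounded h" and pos: "0 < \<alpha>" "0 < t"
    and eq: "\<And>t. 0 < t \<Longrightarrow> m t = c + rl_integral \<alpha> (\<lambda>s. h s + a * m s) t"
  shows "m t = (\<Sum>k<Suc n. a ^ k * (c * (t powr (\<alpha> * real k) / Gamma (\<alpha> * real k + 1)) +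
      rl_integral (\<alpha> * real k + \<alpha>) h t)) + a ^ Suc n * rl_integral (\<alpha> * real n + \<alpha>) m t"
proof (induction n)
  case 0
  have "m t = c + (rl_integral \<alpha> h t + a * rl_integral \<alpha> m t)"
    using eq[OF pos(2)] rl_integral_add[OF h locally_bounded_cmult[OF m, of a] pos(2,1)]
    by (simp add: rl_integral_cmult)
  then show ?case using pos by simp
next
  case (Suc n)
  have "0 < \<alpha> * real n + \<alpha>" using pos by (simp add: add_nonneg_pos)
  then have step: "rl_integral (\<alpha> * real n + \<alpha>) m t =
      c * (t powr (\<alpha> * real n + \<alpha>) / Gamma (\<alpha> * real n + \<alpha> + 1)) +
      rl_integral (\<alpha> * real n + \<alpha> + \<alpha>) h t + a * rl_integral (\<alpha> * real n + \<alpha> + \<alpha>) m t"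
    by (intro volterra_step[OF m h pos(1) _ pos(2)] eq)
  have *: "\<alpha> * real (Suc n) = \<alpha> * real n + \<alpha>" by (simp add: algebra_simps)
  have "a ^ Suc n * rl_integral (\<alpha> * real n + \<alpha>) m t =
      a ^ Suc n * (c * (t powr (\<alpha> * real n + \<alpha>) / Gamma (\<alpha> * real n + \<alpha> + 1)) +
        rl_integral (\<alpha> * real n + \<alpha> + \<alpha>) h t) +
      a ^ Suc (Suc n) * rl_integral (\<alpha> * real n + \<alpha> + \<alpha>) m t"
    unfolding step by (simp add: algebra_simps)
  with Suc show ?case
    unfolding sum.lessThan_Suc[of _ "Suc n"] * by linarith
qed

text \<open>Expanding every \<open>J\<^bsup>k\<alpha>+\<alpha>\<^esup> m\<close> on the left by the equation for \<open>m\<close>: each one contributes to all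
  orders \<open>r \<ge> k\<close>, so that order \<open>r\<close> collects the weight \<open>r + 1\<close>.\<close>

lemma volterra_iterate2:
  assumes m: "locally_bounded m" and h: "locally_bounded h" and pos: "0 < \<alpha>" "0 < t"
    and eq: "\<And>t. 0 < t \<Longrightarrow> m t = c + rl_integral \<alpha> (\<lambda>s. h s + a * m s) t"
  shows "(\<Sum>k<n. a ^ k * rl_integral (\<alpha> * real k + \<alpha>) m t) =
    (\<Sum>r<n. (real r + 1) * a ^ r * (c * (t powr (\<alpha> * real r + \<alpha>) / Gamma (\<alpha> * real r + \<alpha> + 1)) +
      rl_integral (\<alpha> * real r + 2 * \<alpha>) h t)) + real n * a ^ n * rl_integral (\<alpha> * real n + \<alpha>) m t"
proof (induction n)
  case 0
  then show ?case by simp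
next
  case (Suc n)
  have "0 < \<alpha> * real n + \<alpha>" using pos by (simp add: add_nonneg_pos)
  then have step: "rl_integral (\<alpha> * real n + \<alpha>) m t =
      c * (t powr (\<alpha> * real n + \<alpha>) / Gamma (\<alpha> * real n + \<alpha> + 1)) +
      rl_integral (\<alpha> * real n + \<alpha> + \<alpha>) h t + a * rl_integral (\<alpha> * real n + \<alpha> + \<alpha>) m t"
    by (intro volterra_step[OF m h pos(1) _ pos(2)] eq)
  have *: "\<alpha> * real (Suc n) = \<alpha> * real n + \<alpha>" "\<alpha> * real n + 2 * \<alpha> = \<alpha> * real n + \<alpha> + \<alpha>"
    by (simp_all add: algebra_simps)
  have "(\<Sum>k<Suc n. a ^ k * rl_integral (\<alpha> * real k + \<alpha>) m t) =
    (\<Sum>r<n. (real r + 1) * a ^ r * (c * (t powr (\<alpha> * real r + \<alpha>) / Gamma (\<alpha> * real r + \<alpha> + 1)) +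
      rl_integral (\<alpha> * real r + 2 * \<alpha>) h t)) + (real n + 1) * a ^ n * rl_integral (\<alpha> * real n + \<alpha>) m t"
    using Suc by (simp add: algebra_simps)
  then show ?case
    by (simp only: step, unfold sum.lessThan_Suc *) (simp add: algebra_simps)
qed

text \<open>Being equal to its Neumann series, a locally bounded solution is unique. No separate estimate of
  the remainder is needed: up to a factor \<open>a\<close> it is the general term of the convergent series for
  the convolution of \<open>m\<close> itself.\<close>

lemma volterra_solution:
  assumes m: "locally_bounded m" and h: "locally_bounded h" and pos: "0 < \<alpha>" "0 < t"
    and eq: "\<And>t. 0 < t \<Longrightarrow> m t = c + rl_integral \<alpha> (\<lambda>s. h s + a * m s) t"
  shows "m t = c * mittag_leffler3 1 \<alpha> 1 (a * t powr \<alpha>) + ml_convolution 1 \<alpha> \<alpha> a h t"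
proof -
  let ?T = "\<lambda>k. a ^ k * (c * (t powr (\<alpha> * real k) / Gamma (\<alpha> * real k + 1)) +
      rl_integral (\<alpha> * real k + \<alpha>) h t)"
  have "?T sums (c * (t powr 0 * mittag_leffler3 1 \<alpha> (0 + 1) (a * t powr \<alpha>)) + ml_convolution 1 \<alpha> \<alpha> a h t)"
    using sums_add[OF sums_mult[OF sums_power_mittag_leffler3[of t 1 \<alpha> 0 a], of c]
        sums_ml_convolution[OF h pos(2) _ pos(1,1), of 1 a]] pos
    by (simp add: ml_coeff_1 algebra_simps)
  then have "(\<lambda>n. \<Sum>k<Suc n. ?T k) \<longlonglongrightarrow>
      c * mittag_leffler3 1 \<alpha> 1 (a * t powr \<alpha>) + ml_convolution 1 \<alpha> \<alpha> a h t"
    unfolding sums_def using pos by (subst filterlim_sequentially_Suc) simp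
  moreover have "(\<lambda>n. a ^ Suc n * rl_integral (\<alpha> * real n + \<alpha>) m t) \<longlonglongrightarrow> 0"
    using tendsto_mult_left[OF summable_LIMSEQ_zero[OF sums_summable[OF
        sums_ml_convolution[OF m pos(2) _ pos(1,1), of 1 a]]], of a]
    by (simp add: ml_coeff_1 mult.assoc)
  ultimately have "(\<lambda>n. (\<Sum>k<Suc n. ?T k) + a ^ Suc n * rl_integral (\<alpha> * real n + \<alpha>) m t) \<longlonglongrightarrow>
      c * mittag_leffler3 1 \<alpha> 1 (a * t powr \<alpha>) + ml_convolution 1 \<alpha> \<alpha> a h t + 0"
    by (rule tendsto_add)
  then have "(\<lambda>n. m t) \<longlonglongrightarrow>
      c * mittag_leffler3 1 \<alpha> 1 (a * t powr \<alpha>) + ml_convolution 1 \<alpha> \<alpha> a h t + 0"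
    by (rule Lim_transform_eventually)
      (intro always_eventually allI volterra_iterate[OF m h pos, symmetric] eq)
  then show ?thesis by (simp add: LIMSEQ_const_iff)
qed

text \<open>Convolving the solution once more with the kernel \<open>\<delta> = 1\<close> yields the kernels with \<open>\<delta> = 2\<close>.\<close>

lemma ml_convolution_volterra_solution:
  assumes m: "locally_bounded m" and h: "locally_bounded h" and pos: "0 < \<alpha>" "0 < t"
    and eq: "\<And>t. 0 < t \<Longrightarrow> m t = c + rl_integral \<alpha> (\<lambda>s. h s + a * m s) t"
  shows "ml_convolution 1 \<alpha> \<alpha> a m t =
    c * (t powr \<alpha> * mittag_leffler3 2 \<alpha> (\<alpha> + 1) (a * t powr \<alpha>)) + ml_convolution 2 \<alpha> (2 * \<alpha>) a h t"
proof -
  let ?T = "\<lambda>r. (real r + 1) * a ^ r * (c * (t powr (\<alpha> * real r + \<alpha>) / Gamma (\<alpha> * real r + \<alpha> + 1)) +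
      rl_integral (\<alpha> * real r + 2 * \<alpha>) h t)"
  note m1 = sums_ml_convolution[OF m pos(2) _ pos(1,1), of 1 a]
  note m2 = sums_ml_convolution[OF m pos(2) _ pos(1,1), of 2 a]
  have "?T sums (c * (t powr \<alpha> * mittag_leffler3 2 \<alpha> (\<alpha> + 1) (a * t powr \<alpha>)) + ml_convolution 2 \<alpha> (2 * \<alpha>) a h t)"
    using sums_add[OF sums_mult[OF sums_power_mittag_leffler3[of t 2 \<alpha> \<alpha> a], of c]
        sums_ml_convolution[OF h pos(2) _ pos(1), of 2 "2 * \<alpha>" a]] pos
    by (simp add: ml_coeff_2 algebra_simps)
  \<comment> \<open>The factor \<open>n\<close> is the difference of the coefficients for \<open>\<delta> = 2\<close> and \<open>\<delta> = 1\<close>.\<close>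
  moreover have "(\<lambda>n. real n * a ^ n * rl_integral (\<alpha> * real n + \<alpha>) m t) \<longlonglongrightarrow> 0"
    using tendsto_diff[OF summable_LIMSEQ_zero[OF sums_summable[OF m2]]
        summable_LIMSEQ_zero[OF sums_summable[OF m1]]]
    by (simp add: ml_coeff_1 ml_coeff_2 algebra_simps)
  ultimately have "(\<lambda>n. (\<Sum>r<n. ?T r) + real n * a ^ n * rl_integral (\<alpha> * real n + \<alpha>) m t) \<longlonglongrightarrow>
      c * (t powr \<alpha> * mittag_leffler3 2 \<alpha> (\<alpha> + 1) (a * t powr \<alpha>)) + ml_convolution 2 \<alpha> (2 * \<alpha>) a h t + 0"
    unfolding sums_def by (rule tendsto_add)
  moreover have "(\<lambda>n. \<Sum>k<n. a ^ k * rl_integral (\<alpha> * real k + \<alpha>) m t) \<longlonglongrightarrow> ml_convolution 1 \<alpha> \<alpha> a m t"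
    using m1 by (simp add: sums_def ml_coeff_1)
  ultimately show ?thesis
    by (subst (asm) volterra_iterate2[OF m h pos eq]) (use LIMSEQ_unique in auto)
qed

section \<open>Inverting the Caputo derivative\<close>

lemma integral_deriv_interior:
  fixes f :: "real \<Rightarrow> real"
  assumes "0 < t" "continuous_on {0..t} f" "\<And>s. 0 < s \<Longrightarrow> s < t \<Longrightarrow> f differentiable (at s)"
    and "set_integrable lborel {0<..<t} (deriv f)"
  shows "(LINT s:{0<..<t}|lborel. deriv f s) = f t - f 0"
proof -
  have "(deriv f has_integral (f t - f 0)) {0..t}"
  proof (rule fundamental_theorem_of_calculus_interior)
    fix s assume "s \<in> {0<..<t}"
    then show "(f has_vector_derivative deriv f s) (at s)"
      using assms(3)[of s] DERIV_deriv_iff_real_differentiable[of f s]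
      by (simp add: has_real_derivative_iff_has_vector_derivative)
  qed (use assms in auto)
  then have "(deriv f has_integral (f t - f 0)) {0<..<t}"
    by (simp add: has_integral_Icc_iff_Ioo)
  then show ?thesis
    using set_borel_integral_eq_integral(2)[OF assms(4)] by (simp add: integral_unique)
qed

text \<open>For \<open>\<alpha> < 1\<close> the Caputo derivative is \<open>J\<^bsup>1-\<alpha>\<^esup> f'\<close>, so that \<open>J\<^sup>\<alpha>\<close> of it is \<open>J\<^sup>1 f'\<close>.\<close>

lemma caputo_deriv_inverse:
  assumes \<alpha>: "0 < \<alpha>" "\<alpha> \<le> 1" and t: "0 < t" and G: "locally_bounded G"
    and diff: "\<And>u. 0 < u \<Longrightarrow> caputo_differentiable \<alpha> f u"
    and eq: "\<And>u. 0 < u \<Longrightarrow> caputo_deriv \<alpha> f u = G u"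
  shows "f t = f 0 + rl_integral \<alpha> G t"
proof (cases "\<alpha> = 1")
  case True
  have d: "f differentiable (at s)" "deriv f s = G s" if "0 < s" for s
    using diff[OF that] eq[OF that] True by (auto simp: caputo_differentiable_def caputo_deriv_def)
  have eq': "indicator {0<..<t} s *\<^sub>R deriv f s =
      indicator {0<..<t} s * ((t - s) powr (1 - 1) / Gamma 1 * G s)" for s
    using d by (auto simp: indicator_def)
  have "set_integrable lborel {0<..<t} (deriv f)"
    unfolding set_integrable_def eq' by (rule integrable_rl_integrand) (use G t in auto)
  moreover have "continuous_on {0..t} f" using diff[OF t] by (simp add: caputo_differentiable_def)
  ultimately have "(LINT s:{0<..<t}|lborel. deriv f s) = f t - f 0"
    using t d by (intro integral_deriv_interior) auto
  then show ?thesis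
    unfolding set_lebesgue_integral_def eq' rl_integral_def[symmetric] True by simp
next
  case False
  then have \<alpha>1: "\<alpha> < 1" using \<alpha> by simp
  have d: "f differentiable (at s)" if "0 < s" for s
    \<comment> \<open>The condition at \<open>u\<close> only speaks about points strictly before \<open>u\<close>.\<close>
    using diff[of "s + 1"] that False by (auto simp: caputo_differentiable_def)
  \<comment> \<open>Only this restriction of the derivative is known to be Borel measurable on the whole line.\<close>
  define f' where "f' s = indicator {0<..<t} s * deriv f s" for s
  define k where "k s = indicator {0<..<t} s * (deriv f s / (t - s) powr \<alpha>)" for s
  have k: "integrable lborel k"
    using diff[OF t] False t
    by (auto simp: caputo_differentiable_def interval_lebesgue_integrable_def set_integrable_def
        zero_ereal_def k_def[abs_def])
  have f'_k: "f' = (\<lambda>s. k s * (t - s) powr \<alpha>)"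
    by (auto simp: f'_def k_def indicator_def fun_eq_iff)
  have f'_meas [measurable]: "f' \<in> borel_measurable borel"
    unfolding f'_k using borel_measurable_integrable[OF k] by simp
  have f'_int: "integrable lborel f'"
  proof (rule Bochner_Integration.integrable_bound)
    show "integrable lborel (\<lambda>s. t powr \<alpha> * k s)" using k by simp
    have "norm (f' s) \<le> norm (t powr \<alpha> * k s)" for s
    proof (cases "0 < s \<and> s < t")
      case True
      then have "\<bar>k s\<bar> * (t - s) powr \<alpha> \<le> \<bar>k s\<bar> * t powr \<alpha>"
        using \<alpha> by (intro mult_left_mono powr_mono2) auto
      then show ?thesis by (simp add: f'_k abs_mult mult.commute)
    next
      case False
      then show ?thesis by (simp add: f'_def)
    qed
    then show "AE s in lborel. norm (f' s) \<le> norm (t powr \<alpha> * k s)" by simp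
  qed simp
  have f't: "indicator {0<..<t} s * ((t - s) powr (\<alpha> + (1 - \<alpha>) - 1) * f' s) = f' s" for s
    by (auto simp: f'_def indicator_def)
  have G_eq: "rl_integral (1 - \<alpha>) f' u = G u" if u: "0 < u" "u < t" for u
  proof -
    have "rl_integral (1 - \<alpha>) f' u =
        (LINT s|lborel. 1 / Gamma (1 - \<alpha>) * (indicator {0<..<u} s * (deriv f s / (u - s) powr \<alpha>)))"
      unfolding rl_integral_def using u
      by (intro Bochner_Integration.integral_cong) (auto simp: f'_def indicator_def powr_minus_divide)
    also have "\<dots> = caputo_deriv \<alpha> f u"
      unfolding integral_mult_right_zero using False u
      by (simp add: caputo_deriv_def interval_lebesgue_integral_def set_lebesgue_integral_def zero_ereal_def)
    finally show ?thesis using eq[OF u(1)] by simp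
  qed
  have "rl_integral \<alpha> G t = rl_integral \<alpha> (rl_integral (1 - \<alpha>) f') t"
    by (rule rl_integral_cong) (simp add: G_eq)
  also have "\<dots> = rl_integral (\<alpha> + (1 - \<alpha>)) f' t"
  proof (rule rl_integral_semigroup_gen)
    show "integrable lborel (\<lambda>s. indicator {0<..<t} s * ((t - s) powr (\<alpha> + (1 - \<alpha>) - 1) * f' s))"
      unfolding f't by (rule f'_int)
  qed (use \<alpha>(1) \<alpha>1 t in simp_all)
  also have "\<dots> = (LINT s:{0<..<t}|lborel. deriv f s)"
    unfolding rl_integral_def set_lebesgue_integral_def
    by (rule Bochner_Integration.integral_cong) (auto simp: f'_def indicator_def)
  also have "\<dots> = f t - f 0"
  proof (rule integral_deriv_interior)
    show "continuous_on {0..t} f" using diff[OF t] by (simp add: caputo_differentiable_def)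
    show "set_integrable lborel {0<..<t} (deriv f)"
      using f'_int by (simp add: set_integrable_def f'_def[abs_def])
  qed (use t d in auto)
  finally show ?thesis by simp
qed

section \<open>Dynkin's formula for the fractional queue\<close>

text \<open>The queue started almost surely from \<open>i\<close>, with a positive catastrophe rate.\<close>

locale fractional_mm1_queue_from = fractional_mm1_queue M X \<alpha> lam \<mu> \<xi>
  for M :: "'a measure" and X :: "real \<Rightarrow> 'a \<Rightarrow> nat" and \<alpha> lam \<mu> \<xi> :: real +
  fixes i :: nat
  assumes start: "AE \<omega> in M. X 0 \<omega> = i" and \<xi>_pos: "0 < \<xi>"
begin

text \<open>The value \<open>E \<phi>(X\<^sub>t)\<close> as a function of time, extended by \<open>0\<close> to \<open>t \<le> 0\<close> so that it is
  Borel measurable on the whole line.\<close>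

definition moment :: "(nat \<Rightarrow> real) \<Rightarrow> real \<Rightarrow> real" where
  "moment \<phi> t = (if 0 < t then expectation (\<lambda>\<omega>. \<phi> (X t \<omega>)) else 0)"

text \<open>The generator of the queue: arrival, service and catastrophe. Truncated subtraction makes the
  service term vanish at the empty queue.\<close>

definition generator :: "(nat \<Rightarrow> real) \<Rightarrow> nat \<Rightarrow> real" where
  "generator \<phi> n = lam * (\<phi> (Suc n) - \<phi> n) + \<mu> * (\<phi> (n - 1) - \<phi> n) + \<xi> * (\<phi> 0 - \<phi> n)"

text \<open>Integrability of \<open>\<phi>(X\<^sub>t)\<close> at all positive times.\<close>

definition moment_finite :: "(nat \<Rightarrow> real) \<Rightarrow> bool" where
  "moment_finite \<phi> \<longleftrightarrow> (\<forall>t>0. integrable M (\<lambda>\<omega>. \<phi> (X t \<omega>)))"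

lemma measurable_fun_X: "0 \<le> t \<Longrightarrow> (\<lambda>\<omega>. f (X t \<omega>) :: real) \<in> borel_measurable M"
  using random_variables[of t] by simp

lemma events_X: "0 \<le> t \<Longrightarrow> {\<omega> \<in> space M. X t \<omega> = n} \<in> events"
  using random_variables[of t] by simp

lemma prob_start: "prob {\<omega> \<in> space M. X 0 \<omega> = i} = 1"
  using start events_X[of 0] by (simp add: prob_Collect_eq_1)

lemma trans_prob_eq_prob:
  assumes "0 \<le> t"
  shows "trans_prob M X i n t = prob {\<omega> \<in> space M. X t \<omega> = n}"
proof -
  note [measurable] = random_variables[OF assms] random_variables[of 0, simplified]
  have "prob {\<omega> \<in> space M. X t \<omega> = n \<and> X 0 \<omega> = i} = prob {\<omega> \<in> space M. X t \<omega> = n}"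
    by (rule prob_eq_AE) (use start in \<open>auto elim: eventually_mono\<close>)
  then show ?thesis
    by (simp add: trans_prob_def cond_prob_def prob_start)
qed

lemma moment_indicator:
  assumes "0 < t"
  shows "moment (indicator {n}) t = trans_prob M X i n t"
proof -
  have "expectation (\<lambda>\<omega>. indicator {n} (X t \<omega>)) =
      expectation (indicator {\<omega> \<in> space M. X t \<omega> = n} :: 'a \<Rightarrow> real)"
    by (rule Bochner_Integration.integral_cong) (auto simp: indicator_def)
  also have "\<dots> = prob {\<omega> \<in> space M. X t \<omega> = n}"
    using events_X[of t n] assms by simp
  finally show ?thesis using assms by (simp add: moment_def trans_prob_eq_prob)
qed

lemma moment_finite_bounded:
  assumes "\<And>n. \<bar>\<phi> n\<bar> \<le> B"
  shows "moment_finite \<phi>"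
  unfolding moment_finite_def
  by (intro allI impI integrable_const_bound[of _ B]) (use assms measurable_fun_X in auto)

lemma moment_finite_indicator: "moment_finite (indicator A)"
  by (rule moment_finite_bounded[of _ 1]) (simp add: indicator_def)

lemma moment_finite_const: "moment_finite (\<lambda>_. c)"
  by (rule moment_finite_bounded[of _ "\<bar>c\<bar>"]) simp

lemma moment_finite_add: "moment_finite \<phi> \<Longrightarrow> moment_finite \<psi> \<Longrightarrow> moment_finite (\<lambda>n. \<phi> n + \<psi> n)"
  by (simp add: moment_finite_def)

lemma moment_finite_cmult: "moment_finite \<phi> \<Longrightarrow> moment_finite (\<lambda>n. c * \<phi> n)"
  by (simp add: moment_finite_def)

lemma moment_finite_mono:
  assumes "moment_finite \<psi>" "\<And>n. \<bar>\<phi> n\<bar> \<le> \<psi> n"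
  shows "moment_finite \<phi>"
  unfolding moment_finite_def
proof (intro allI impI)
  fix t :: real assume t: "0 < t"
  have *: "\<bar>\<phi> n\<bar> \<le> \<bar>\<psi> n\<bar>" for n using assms(2)[of n] by linarith
  show "integrable M (\<lambda>\<omega>. \<phi> (X t \<omega>))"
    by (rule Bochner_Integration.integrable_bound[of _ "\<lambda>\<omega>. \<psi> (X t \<omega>)"])
       (use assms(1) t * measurable_fun_X[of t] in \<open>auto simp: moment_finite_def\<close>)
qed

lemma moment_const: "0 < t \<Longrightarrow> moment (\<lambda>_. c) t = c"
  by (simp add: moment_def prob_space)

lemma moment_add:
  "moment_finite \<phi> \<Longrightarrow> moment_finite \<psi> \<Longrightarrow> moment (\<lambda>n. \<phi> n + \<psi> n) t = moment \<phi> t + moment \<psi> t"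
  by (simp add: moment_def moment_finite_def)

lemma moment_cmult: "moment (\<lambda>n. c * \<phi> n) t = c * moment \<phi> t"
  by (simp add: moment_def)

lemma moment_mono:
  assumes "moment_finite \<phi>" "moment_finite \<psi>" "\<And>n. \<phi> n \<le> \<psi> n"
  shows "moment \<phi> t \<le> moment \<psi> t"
  using assms by (auto simp: moment_def moment_finite_def intro!: integral_mono)

lemma moment_abs_le:
  assumes "moment_finite \<psi>" "\<And>n. \<bar>\<phi> n\<bar> \<le> \<psi> n"
  shows "\<bar>moment \<phi> t\<bar> \<le> moment \<psi> t"
proof -
  have f: "moment_finite \<phi>" by (rule moment_finite_mono[OF assms])
  have "moment \<phi> t \<le> moment \<psi> t"
    by (rule moment_mono[OF f assms(1)]) (use assms(2) in \<open>auto simp: abs_le_iff\<close>)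
  moreover have "moment (\<lambda>n. -1 * \<phi> n) t \<le> moment \<psi> t"
    by (rule moment_mono[OF moment_finite_cmult[OF f] assms(1)]) (use assms(2) in \<open>auto simp: abs_le_iff\<close>)
  ultimately show ?thesis unfolding moment_cmult by linarith
qed

lemma moment_dominated_convergence:
  assumes "moment_finite \<psi>" "\<And>N n. \<bar>\<phi> N n\<bar> \<le> \<psi> n" "\<And>n. (\<lambda>N. \<phi> N n) \<longlonglongrightarrow> \<phi>' n"
  shows "(\<lambda>N. moment (\<phi> N) t) \<longlonglongrightarrow> moment \<phi>' t"
proof (cases "0 < t")
  case True
  have "(\<lambda>N. expectation (\<lambda>\<omega>. \<phi> N (X t \<omega>))) \<longlonglongrightarrow> expectation (\<lambda>\<omega>. \<phi>' (X t \<omega>))"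
    by (rule integral_dominated_convergence[where w = "\<lambda>\<omega>. \<psi> (X t \<omega>)"])
       (use assms True measurable_fun_X[of t] in \<open>auto simp: moment_finite_def\<close>)
  then show ?thesis using True by (simp add: moment_def)
qed (simp add: moment_def)

lemma trans_prob_differentiable:
  assumes "0 < t"
  shows "trans_prob M X i n differentiable (at t)"
  using caputo_differentiable[of i "t + 1" n] caputo_differentiable[of i t n] assms
  by (auto simp: prob_start caputo_differentiable_def split: if_splits)

text \<open>Nothing is known about joint measurability of the process in time and \<open>\<omega>\<close>; measurability in time
  comes from the continuity of the transition probabilities, of which every moment is a series.\<close>

lemma borel_measurable_moment:
  assumes "moment_finite \<phi>"
  shows "moment \<phi> \<in> borel_measurable borel"
proof -
  have eq: "(\<Sum>k<N. \<phi> k * indicator {k} n) = (if n < N then \<phi> n else 0)" for N n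
    by (simp add: indicator_def if_distrib sum.delta' cong: if_cong)
  have "moment (indicator {n}) \<in> borel_measurable borel" for n
  proof -
    have "(\<lambda>t. indicator {0<..} t *\<^sub>R trans_prob M X i n t) \<in> borel_measurable borel"
      by (intro borel_measurable_continuous_on_indicator continuous_at_imp_continuous_on)
         (auto intro!: differentiable_imp_continuous_within trans_prob_differentiable)
    also have "(\<lambda>t. indicator {0<..} t *\<^sub>R trans_prob M X i n t) = moment (indicator {n})"
      by (auto simp: fun_eq_iff indicator_def moment_indicator) (auto simp: moment_def)
    finally show ?thesis .
  qed
  then have 1: "moment (\<lambda>n. \<Sum>k<N. \<phi> k * indicator {k} n) \<in> borel_measurable borel" for N
  proof (induction N)
    case 0
    then show ?case by (simp add: moment_def[abs_def])
  next
    case (Suc N)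
    have "moment_finite (\<lambda>n. \<Sum>k<N. \<phi> k * indicator {k} n)"
      by (rule moment_finite_bounded[of _ "\<Sum>k<N. \<bar>\<phi> k\<bar>"])
         (auto simp: eq sum_nonneg intro!: member_le_sum[where f = "\<lambda>k. \<bar>\<phi> k\<bar>"])
    then have "moment (\<lambda>n. \<Sum>k<Suc N. \<phi> k * indicator {k} n) = (\<lambda>t.
        moment (\<lambda>n. \<Sum>k<N. \<phi> k * indicator {k} n) t + \<phi> N * moment (indicator {N}) t)"
      by (simp add: fun_eq_iff moment_add moment_cmult moment_finite_cmult moment_finite_indicator)
    then show ?case using Suc by simp
  qed
  have "moment_finite (\<lambda>n. \<bar>\<phi> n\<bar>)"
    using assms by (simp add: moment_finite_def)
  then have "(\<lambda>N. moment (\<lambda>n. \<Sum>k<N. \<phi> k * indicator {k} n) t) \<longlonglongrightarrow> moment \<phi> t" for t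
  proof (rule moment_dominated_convergence)
    fix n
    have "eventually (\<lambda>N. (\<Sum>k<N. \<phi> k * indicator {k} n) = \<phi> n) sequentially"
      using eventually_gt_at_top[of n] by eventually_elim (simp add: eq)
    then show "(\<lambda>N. \<Sum>k<N. \<phi> k * indicator {k} n) \<longlonglongrightarrow> \<phi> n"
      by (rule tendsto_eventually)
  qed (simp add: eq)
  then show ?thesis
    by (rule borel_measurable_LIMSEQ_real) (rule 1)
qed

lemma locally_bounded_moment_bounded:
  assumes "\<And>n. \<bar>\<phi> n\<bar> \<le> B"
  shows "locally_bounded (moment \<phi>)"
proof (rule locally_boundedI)
  show "moment \<phi> \<in> borel_measurable borel"
    by (rule borel_measurable_moment[OF moment_finite_bounded[OF assms]])
  have "\<bar>moment \<phi> t\<bar> \<le> B" if "0 < t" for t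
  proof -
    have "\<bar>moment \<phi> t\<bar> \<le> moment (\<lambda>_. B) t"
      by (rule moment_abs_le[OF moment_finite_const assms])
    then show ?thesis using that by (simp add: moment_const)
  qed
  then show "\<exists>B. \<forall>s\<in>{0<..T}. \<bar>moment \<phi> s\<bar> \<le> B" for T
    by (intro exI[of _ B]) auto
qed

lemma generator_bounded:
  assumes "\<And>n. \<bar>\<phi> n\<bar> \<le> B"
  shows "\<bar>generator \<phi> n\<bar> \<le> (lam + \<mu> + \<xi>) * (2 * B)"
proof -
  have *: "\<bar>\<phi> m - \<phi> n\<bar> \<le> 2 * B" for m
    using assms[of m] assms[of n] by linarith
  have "\<bar>generator \<phi> n\<bar> \<le> \<bar>lam * (\<phi> (Suc n) - \<phi> n)\<bar> + \<bar>\<mu> * (\<phi> (n - 1) - \<phi> n)\<bar> + \<bar>\<xi> * (\<phi> 0 - \<phi> n)\<bar>"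
    unfolding generator_def by linarith
  also have "\<dots> \<le> lam * (2 * B) + \<mu> * (2 * B) + \<xi> * (2 * B)"
    using rates by (auto simp: abs_mult intro!: add_mono mult_left_mono *)
  finally show ?thesis by (simp add: algebra_simps)
qed

text \<open>The integrated form \<open>E \<phi>(X\<^sub>t) = \<phi>(i) + J\<^sup>\<alpha>(E (A \<phi>)(X\<^sub>s))(t)\<close> of the equations of the queue,
  tested against \<open>\<phi>\<close>, where \<open>A\<close> is the generator.\<close>

definition dynkin :: "(nat \<Rightarrow> real) \<Rightarrow> bool" where
  "dynkin \<phi> \<longleftrightarrow> (\<forall>t>0. moment \<phi> t = \<phi> i + rl_integral \<alpha> (moment (generator \<phi>)) t)"

text \<open>The forward equations say that the Caputo derivative of \<open>P(X\<^sub>t = n)\<close> is the moment of the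
  generator applied to the indicator of \<open>n\<close>; the inhomogeneity \<open>\<xi>\<close> at \<open>n = 0\<close> is \<open>\<xi>\<close> times the total
  mass.\<close>

lemma caputo_deriv_trans_prob:
  assumes "0 < t"
  shows "caputo_deriv \<alpha> (trans_prob M X i n) t = moment (generator (indicator {n})) t"
proof (cases "n = 0")
  case True
  have "generator (indicator {0}) = (\<lambda>n. - (lam + \<xi>) * indicator {0} n + (\<mu> * indicator {1} n + \<xi>))"
    by (auto simp: generator_def indicator_def fun_eq_iff algebra_simps)
  then have "moment (generator (indicator {0})) t =
      - (lam + \<xi>) * moment (indicator {0}) t + (\<mu> * moment (indicator {1}) t + \<xi>)"
    using assms by (simp only: moment_add moment_cmult moment_const moment_finite_add
        moment_finite_cmult moment_finite_indicator moment_finite_const)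
  then show ?thesis
    using True equation_0[of i t] assms by (simp add: prob_start moment_indicator)
next
  case False
  then have "generator (indicator {n}) = (\<lambda>m. - (lam + \<mu> + \<xi>) * indicator {n} m +
      (lam * indicator {n - 1} m + \<mu> * indicator {n + 1} m))"
    by (auto simp: generator_def indicator_def fun_eq_iff algebra_simps)
  then have "moment (generator (indicator {n})) t =
      - (lam + \<mu> + \<xi>) * moment (indicator {n}) t +
      (lam * moment (indicator {n - 1}) t + \<mu> * moment (indicator {n + 1}) t)"
    by (simp only: moment_add moment_cmult moment_finite_add
        moment_finite_cmult moment_finite_indicator)
  then show ?thesis
    using False equation_n[of i t n] assms by (simp add: prob_start moment_indicator)
qed

lemma dynkin_indicator: "dynkin (indicator {n})"
  unfolding dynkin_def
proof (intro allI impI)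
  fix t :: real assume t: "0 < t"
  have b: "\<bar>indicator {n} m :: real\<bar> \<le> 1" for m by (simp add: indicator_def)
  have "trans_prob M X i n t = trans_prob M X i n 0 + rl_integral \<alpha> (moment (generator (indicator {n}))) t"
    using order t caputo_differentiable[of i] caputo_deriv_trans_prob
    by (intro caputo_deriv_inverse locally_bounded_moment_bounded[OF generator_bounded[OF b]])
       (auto simp: prob_start)
  then show "moment (indicator {n}) t = indicator {n} i + rl_integral \<alpha> (moment (generator (indicator {n}))) t"
    using initial[of i n] t by (simp add: moment_indicator prob_start indicator_def)
qed

lemma dynkin_linear:
  assumes \<phi>: "dynkin \<phi>" "\<And>n. \<bar>\<phi> n\<bar> \<le> B" and \<psi>: "dynkin \<psi>" "\<And>n. \<bar>\<psi> n\<bar> \<le> C"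
  shows "dynkin (\<lambda>n. \<phi> n + c * \<psi> n)"
  unfolding dynkin_def
proof (intro allI impI)
  fix t :: real assume t: "0 < t"
  have fin: "moment_finite \<phi>" "moment_finite \<psi>"
      "moment_finite (generator \<phi>)" "moment_finite (generator \<psi>)"
    using \<phi>(2) \<psi>(2) by (blast intro: moment_finite_bounded generator_bounded)+
  have lb: "locally_bounded (moment (generator \<phi>))" "locally_bounded (moment (generator \<psi>))"
    using \<phi>(2) \<psi>(2) by (blast intro: locally_bounded_moment_bounded generator_bounded)+
  have "generator (\<lambda>n. \<phi> n + c * \<psi> n) = (\<lambda>n. generator \<phi> n + c * generator \<psi> n)"
    by (simp add: generator_def fun_eq_iff algebra_simps)
  then have "moment (generator (\<lambda>n. \<phi> n + c * \<psi> n)) =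
      (\<lambda>s. moment (generator \<phi>) s + c * moment (generator \<psi>) s)"
    using fin by (intro ext) (simp add: moment_add moment_cmult moment_finite_cmult)
  then have "rl_integral \<alpha> (moment (generator (\<lambda>n. \<phi> n + c * \<psi> n))) t =
      rl_integral \<alpha> (moment (generator \<phi>)) t + c * rl_integral \<alpha> (moment (generator \<psi>)) t"
    using rl_integral_add[OF lb(1) locally_bounded_cmult[OF lb(2), of c] t order(1)]
    by (simp add: rl_integral_cmult)
  moreover have "moment (\<lambda>n. \<phi> n + c * \<psi> n) t = moment \<phi> t + c * moment \<psi> t"
    using fin by (simp add: moment_add moment_cmult moment_finite_cmult)
  ultimately show "moment (\<lambda>n. \<phi> n + c * \<psi> n) t = \<phi> i + c * \<psi> i +
      rl_integral \<alpha> (moment (generator (\<lambda>n. \<phi> n + c * \<psi> n))) t"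
    using \<phi>(1) \<psi>(1) t by (simp add: dynkin_def algebra_simps)
qed

lemma eventually_const_bounded:
  fixes \<phi> :: "nat \<Rightarrow> real"
  assumes "\<And>n. N \<le> n \<Longrightarrow> \<phi> n = \<phi> N"
  shows "\<bar>\<phi> n\<bar> \<le> (\<Sum>k\<le>N. \<bar>\<phi> k\<bar>)"
proof -
  have "\<bar>\<phi> n\<bar> = \<bar>\<phi> (min n N)\<bar>" using assms[of n] by (simp add: min_def)
  also have "\<dots> \<le> (\<Sum>k\<le>N. \<bar>\<phi> k\<bar>)" by (rule member_le_sum) auto
  finally show ?thesis .
qed

text \<open>An eventually constant function is a finite combination of indicators and a constant, so no
  infinite system has to be summed at this stage.\<close>

lemma dynkin_eventually_const:
  assumes "\<And>n. N \<le> n \<Longrightarrow> \<phi> n = \<phi> N"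
  shows "dynkin \<phi>"
  using assms
proof (induction N arbitrary: \<phi>)
  case 0
  then have "\<phi> = (\<lambda>_. \<phi> 0)" by auto
  then obtain c where c: "\<phi> = (\<lambda>_. c)" by blast
  have "generator (\<lambda>_. c) = (\<lambda>_. 0)" by (simp add: generator_def fun_eq_iff)
  moreover have "moment (\<lambda>_. 0) = (\<lambda>_. 0)" by (simp add: moment_def fun_eq_iff)
  ultimately show ?case
    by (simp add: dynkin_def c moment_const rl_integral_def)
next
  case (Suc N)
  define \<phi>' where "\<phi>' = \<phi>(N := \<phi> (Suc N))"
  have const: "\<phi>' n = \<phi>' N" if "N \<le> n" for n
    using Suc.prems[of n] that by (cases "n = N") (auto simp: \<phi>'_def)
  have "dynkin (\<lambda>n. \<phi>' n + (\<phi> N - \<phi> (Suc N)) * indicator {N} n)"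
  proof (rule dynkin_linear)
    show "dynkin \<phi>'" by (rule Suc.IH) (rule const)
    show "\<bar>\<phi>' n\<bar> \<le> (\<Sum>k\<le>N. \<bar>\<phi>' k\<bar>)" for n by (rule eventually_const_bounded) (rule const)
    show "dynkin (indicator {N})" by (rule dynkin_indicator)
    show "\<bar>indicator {N} n :: real\<bar> \<le> 1" for n by (simp add: indicator_def)
  qed
  also have "(\<lambda>n. \<phi>' n + (\<phi> N - \<phi> (Suc N)) * indicator {N} n) = \<phi>"
    by (auto simp: \<phi>'_def fun_eq_iff)
  finally show ?case .
qed

section \<open>Second moments\<close>

text \<open>Catastrophes dominate: \<open>\<xi> n\<^sup>2\<close> outweighs the linear growth \<open>2 lam n\<close> of the square, so the
  generator of every truncated square is bounded above by one constant.\<close>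

lemma generator_truncated_square_le:
  "generator (\<lambda>n. (real (min n N))\<^sup>2) n \<le> lam + lam\<^sup>2 / \<xi>"
proof -
  have C: "0 \<le> lam\<^sup>2 / \<xi>" using \<xi>_pos by simp
  have serve: "\<mu> * ((real (min (n - 1) N))\<^sup>2 - (real (min n N))\<^sup>2) \<le> 0"
    using rates by (intro mult_nonneg_nonpos) (auto intro!: power_mono)
  show ?thesis
  proof (cases "n < N")
    case True
    have "0 \<le> \<xi> * (real n - lam / \<xi>)\<^sup>2" using \<xi>_pos by simp
    also have "\<dots> = \<xi> * (real n)\<^sup>2 - 2 * lam * real n + lam\<^sup>2 / \<xi>"
      using \<xi>_pos by (simp add: power2_eq_square field_simps)
    finally have "lam * (2 * real n + 1) - \<xi> * (real n)\<^sup>2 \<le> lam + lam\<^sup>2 / \<xi>"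
      by (simp add: algebra_simps)
    moreover have "generator (\<lambda>n. (real (min n N))\<^sup>2) n = lam * (2 * real n + 1) +
        \<mu> * ((real (min (n - 1) N))\<^sup>2 - (real (min n N))\<^sup>2) - \<xi> * (real n)\<^sup>2"
      using True by (simp add: generator_def min_absorb1 power2_eq_square algebra_simps)
    ultimately show ?thesis using serve by linarith
  next
    case False
    have "0 \<le> \<xi> * (real N)\<^sup>2" using rates by simp
    moreover have "generator (\<lambda>n. (real (min n N))\<^sup>2) n =
        \<mu> * ((real (min (n - 1) N))\<^sup>2 - (real (min n N))\<^sup>2) - \<xi> * (real N)\<^sup>2"
      using False by (simp add: generator_def min_absorb2)
    ultimately show ?thesis using serve C rates by linarith
  qed
qed

lemma moment_truncated_square_le:
  assumes "0 < t"
  shows "moment (\<lambda>n. (real (min n N))\<^sup>2) t \<le>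
    (real i)\<^sup>2 + (lam + lam\<^sup>2 / \<xi>) * (t powr \<alpha> / Gamma (\<alpha> + 1))"
proof -
  let ?\<phi> = "\<lambda>n. (real (min n N))\<^sup>2"
  have b: "\<bar>?\<phi> n\<bar> \<le> (real N)\<^sup>2" for n by (auto intro!: power_mono)
  have fin: "moment_finite (generator ?\<phi>)" and lb: "locally_bounded (moment (generator ?\<phi>))"
    using b by (blast intro: moment_finite_bounded locally_bounded_moment_bounded generator_bounded)+
  have "moment (generator ?\<phi>) s \<le> lam + lam\<^sup>2 / \<xi>" if "0 < s" for s
  proof -
    have "moment (generator ?\<phi>) s \<le> moment (\<lambda>_. lam + lam\<^sup>2 / \<xi>) s"
      by (rule moment_mono[OF fin moment_finite_const generator_truncated_square_le])
    then show ?thesis using that by (simp add: moment_const)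
  qed
  then have "rl_integral \<alpha> (moment (generator ?\<phi>)) t \<le> rl_integral \<alpha> (\<lambda>_. lam + lam\<^sup>2 / \<xi>) t"
    by (intro rl_integral_mono lb locally_bounded_const assms order)
  moreover have "dynkin ?\<phi>" by (rule dynkin_eventually_const[of N]) simp
  then have "moment ?\<phi> t = ?\<phi> i + rl_integral \<alpha> (moment (generator ?\<phi>)) t"
    using assms by (simp add: dynkin_def)
  moreover have "?\<phi> i \<le> (real i)\<^sup>2" by (auto intro!: power_mono)
  ultimately show ?thesis unfolding rl_integral_const[OF assms order(1)] by linarith
qed

lemma moment_square:
  shows moment_finite_square: "moment_finite (\<lambda>n. (real n)\<^sup>2)"
    and moment_square_le: "0 < t \<Longrightarrow> moment (\<lambda>n. (real n)\<^sup>2) t \<le>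
      (real i)\<^sup>2 + (lam + lam\<^sup>2 / \<xi>) * (t powr \<alpha> / Gamma (\<alpha> + 1))"
proof -
  have *: "integrable M (\<lambda>\<omega>. (real (X t \<omega>))\<^sup>2) \<and> moment (\<lambda>n. (real n)\<^sup>2) t \<le>
      (real i)\<^sup>2 + (lam + lam\<^sup>2 / \<xi>) * (t powr \<alpha> / Gamma (\<alpha> + 1))" (is "_ \<and> _ \<le> ?B")
    if t: "0 < t" for t
  proof -
    let ?f = "\<lambda>N \<omega>. (real (min (X t \<omega>) N))\<^sup>2"
    have b: "\<bar>(real (min n N))\<^sup>2\<bar> \<le> (real N)\<^sup>2" for n N :: nat by (auto intro!: power_mono)
    have int: "integrable M (?f N)" for N
    proof -
      have "moment_finite (\<lambda>n. (real (min n N))\<^sup>2)" by (rule moment_finite_bounded) (rule b)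
      then show ?thesis using t by (simp add: moment_finite_def)
    qed
    have le: "expectation (?f N) \<le> ?B" for N
      using moment_truncated_square_le[OF t, of N] t by (simp add: moment_def)
    have mono: "mono (\<lambda>N. ?f N \<omega>)" for \<omega>
      by (auto intro!: monoI power_mono)
    have lim: "(\<lambda>N. ?f N \<omega>) \<longlonglongrightarrow> (real (X t \<omega>))\<^sup>2" for \<omega>
    proof (rule tendsto_eventually)
      show "eventually (\<lambda>N. ?f N \<omega> = (real (X t \<omega>))\<^sup>2) sequentially"
        using eventually_ge_at_top[of "X t \<omega>"] by eventually_elim simp
    qed
    have "incseq (\<lambda>N. expectation (?f N))"
      using mono by (auto intro!: incseq_SucI integral_mono int simp: mono_def)
    then obtain L where L: "(\<lambda>N. expectation (?f N)) \<longlonglongrightarrow> L"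
      using incseq_convergent[of "\<lambda>N. expectation (?f N)" ?B] le by blast
    have "integrable M (\<lambda>\<omega>. (real (X t \<omega>))\<^sup>2)" "expectation (\<lambda>\<omega>. (real (X t \<omega>))\<^sup>2) = L"
      using integral_monotone_convergence_nonneg[OF int _ _ _ L, of "\<lambda>\<omega>. (real (X t \<omega>))\<^sup>2"]
        mono lim measurable_fun_X[of t "\<lambda>n. (real n)\<^sup>2"] t by auto
    moreover have "L \<le> ?B" using L le by (intro LIMSEQ_le_const2) auto
    ultimately show ?thesis using t by (simp add: moment_def)
  qed
  show "moment_finite (\<lambda>n. (real n)\<^sup>2)" using * by (simp add: moment_finite_def)
  show "0 < t \<Longrightarrow> moment (\<lambda>n. (real n)\<^sup>2) t \<le>
      (real i)\<^sup>2 + (lam + lam\<^sup>2 / \<xi>) * (t powr \<alpha> / Gamma (\<alpha> + 1))" using * by simp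
qed

lemma moment_finite_quadratic:
  assumes "\<And>n. \<bar>\<phi> n\<bar> \<le> c * (1 + (real n)\<^sup>2)"
  shows "moment_finite \<phi>"
  by (rule moment_finite_mono[OF moment_finite_cmult[OF moment_finite_add[OF
    moment_finite_const moment_finite_square]] assms])

lemma moment_quadratic_le:
  assumes "\<And>n. \<bar>\<phi> n\<bar> \<le> c * (1 + (real n)\<^sup>2)" and t: "0 < t" "t \<le> T"
  shows "\<bar>moment \<phi> t\<bar> \<le> c * (1 + ((real i)\<^sup>2 + (lam + lam\<^sup>2 / \<xi>) * (T powr \<alpha> / Gamma (\<alpha> + 1))))"
proof -
  have c: "0 \<le> c" using assms(1)[of 0] by simp
  have "\<bar>moment \<phi> t\<bar> \<le> moment (\<lambda>n. c * (1 + (real n)\<^sup>2)) t"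
    by (intro moment_abs_le assms(1) moment_finite_cmult moment_finite_add
        moment_finite_const moment_finite_square)
  also have "\<dots> = c * (1 + moment (\<lambda>n. (real n)\<^sup>2) t)"
    using t moment_finite_square by (simp add: moment_cmult moment_add moment_finite_const moment_const)
  also have "\<dots> \<le> c * (1 + ((real i)\<^sup>2 + (lam + lam\<^sup>2 / \<xi>) * (t powr \<alpha> / Gamma (\<alpha> + 1))))"
    using moment_square_le[OF t(1)] c by (intro mult_left_mono) auto
  also have "\<dots> \<le> c * (1 + ((real i)\<^sup>2 + (lam + lam\<^sup>2 / \<xi>) * (T powr \<alpha> / Gamma (\<alpha> + 1))))"
    using t order rates \<xi>_pos c Gamma_real_pos[of "\<alpha> + 1"]
    by (intro mult_left_mono add_left_mono divide_right_mono powr_mono2 add_nonneg_nonneg) auto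
  finally show ?thesis .
qed

lemma locally_bounded_moment_quadratic:
  assumes "\<And>n. \<bar>\<phi> n\<bar> \<le> c * (1 + (real n)\<^sup>2)"
  shows "locally_bounded (moment \<phi>)"
proof (rule locally_boundedI)
  show "moment \<phi> \<in> borel_measurable borel"
    by (rule borel_measurable_moment[OF moment_finite_quadratic[OF assms]])
  show "\<exists>B. \<forall>s\<in>{0<..T}. \<bar>moment \<phi> s\<bar> \<le> B" for T
  proof (intro exI ballI)
    fix s assume "s \<in> {0<..T}"
    then show "\<bar>moment \<phi> s\<bar> \<le>
        c * (1 + ((real i)\<^sup>2 + (lam + lam\<^sup>2 / \<xi>) * (T powr \<alpha> / Gamma (\<alpha> + 1))))"
      by (intro moment_quadratic_le assms) auto
  qed
qed

lemma generator_quadratic: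
  assumes "\<And>n. \<bar>\<phi> n\<bar> \<le> c * (1 + (real n)\<^sup>2)"
  shows "\<bar>generator \<phi> n\<bar> \<le> (lam + \<mu> + \<xi>) * (4 * c) * (1 + (real n)\<^sup>2)"
proof -
  define q where "q = 1 + (real n)\<^sup>2"
  have c: "0 \<le> c" using assms[of 0] by simp
  have *: "\<bar>\<phi> m - \<phi> n\<bar> \<le> 4 * c * q" if "m \<le> Suc n" for m
  proof -
    have "(real m)\<^sup>2 \<le> (real n + 1)\<^sup>2" using that by (intro power_mono) auto
    also have "\<dots> \<le> 2 * (real n)\<^sup>2 + 2"
      using sum_squares_ge_zero[of "real n - 1" 0] by (simp add: power2_eq_square algebra_simps)
    finally have "1 + (real m)\<^sup>2 \<le> 3 * q"
      unfolding q_def using zero_le_power2[of "real n"] by argo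
    then have "c * (1 + (real m)\<^sup>2) \<le> c * (3 * q)" using c by (rule mult_left_mono)
    then show ?thesis using assms[of m] assms[of n] unfolding q_def by (simp add: algebra_simps)
  qed
  have "\<bar>generator \<phi> n\<bar> \<le> \<bar>lam * (\<phi> (Suc n) - \<phi> n)\<bar> + \<bar>\<mu> * (\<phi> (n - 1) - \<phi> n)\<bar> + \<bar>\<xi> * (\<phi> 0 - \<phi> n)\<bar>"
    unfolding generator_def by linarith
  also have "\<dots> \<le> lam * (4 * c * q) + \<mu> * (4 * c * q) + \<xi> * (4 * c * q)"
    unfolding abs_mult using rates *[of "Suc n"] *[of "n - 1"] *[of 0]
    by (intro add_mono mult_mono) auto
  finally show ?thesis unfolding q_def by (simp add: algebra_simps)
qed

text \<open>Passing to the limit in the truncations \<open>\<phi>(min n N)\<close>, dominated by the second moment.\<close>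

lemma dynkin_quadratic:
  assumes bound: "\<And>n. \<bar>\<phi> n\<bar> \<le> c * (1 + (real n)\<^sup>2)"
  shows "dynkin \<phi>"
  unfolding dynkin_def
proof (intro allI impI)
  fix t :: real assume t: "0 < t"
  define \<psi> where "\<psi> N n = \<phi> (min n N)" for N n
  have c: "0 \<le> c" using bound[of 0] by simp
  have \<psi>_bound: "\<bar>\<psi> N n\<bar> \<le> c * (1 + (real n)\<^sup>2)" for N n
  proof -
    have "\<bar>\<psi> N n\<bar> \<le> c * (1 + (real (min n N))\<^sup>2)" unfolding \<psi>_def by (rule bound)
    also have "\<dots> \<le> c * (1 + (real n)\<^sup>2)" using c by (intro mult_left_mono add_left_mono power_mono) auto
    finally show ?thesis .
  qed
  have \<psi>_lim: "(\<lambda>N. \<psi> N n) \<longlonglongrightarrow> \<phi> n" for n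
  proof (rule tendsto_eventually)
    show "eventually (\<lambda>N. \<psi> N n = \<phi> n) sequentially"
      using eventually_ge_at_top[of n] by eventually_elim (simp add: \<psi>_def)
  qed
  have gen_lim: "(\<lambda>N. generator (\<psi> N) n) \<longlonglongrightarrow> generator \<phi> n" for n
    unfolding generator_def by (intro tendsto_intros \<psi>_lim)
  let ?q = "\<lambda>c n. c * (1 + (real n)\<^sup>2)"
  have fin: "moment_finite (?q c)" for c
    by (intro moment_finite_cmult moment_finite_add moment_finite_const moment_finite_square)
  have "(\<lambda>N. rl_integral \<alpha> (moment (generator (\<psi> N))) t) \<longlonglongrightarrow> rl_integral \<alpha> (moment (generator \<phi>)) t"
  proof (rule rl_integral_dominated_convergence)
    show "locally_bounded (moment (generator (\<psi> N)))" for N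
      by (rule locally_bounded_moment_quadratic[OF generator_quadratic[OF \<psi>_bound]])
    show "locally_bounded (moment (generator \<phi>))"
      by (rule locally_bounded_moment_quadratic[OF generator_quadratic[OF bound]])
    show "\<bar>moment (generator (\<psi> N)) s\<bar> \<le> (lam + \<mu> + \<xi>) * (4 * c) *
        (1 + ((real i)\<^sup>2 + (lam + lam\<^sup>2 / \<xi>) * (t powr \<alpha> / Gamma (\<alpha> + 1))))"
      if "0 < s" "s < t" for N s
      by (rule moment_quadratic_le[OF generator_quadratic[OF \<psi>_bound]]) (use that in auto)
    show "(\<lambda>N. moment (generator (\<psi> N)) s) \<longlonglongrightarrow> moment (generator \<phi>) s" for s
      by (rule moment_dominated_convergence[OF fin generator_quadratic[OF \<psi>_bound] gen_lim])
  qed (use t order in auto)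
  then have "(\<lambda>N. \<psi> N i + rl_integral \<alpha> (moment (generator (\<psi> N))) t) \<longlonglongrightarrow>
      \<phi> i + rl_integral \<alpha> (moment (generator \<phi>)) t"
    by (intro tendsto_add \<psi>_lim)
  moreover have "moment (\<psi> N) t = \<psi> N i + rl_integral \<alpha> (moment (generator (\<psi> N))) t" for N
    using dynkin_eventually_const[of N "\<psi> N"] t by (simp add: dynkin_def \<psi>_def)
  moreover have "(\<lambda>N. moment (\<psi> N) t) \<longlonglongrightarrow> moment \<phi> t"
    by (rule moment_dominated_convergence[OF fin \<psi>_bound \<psi>_lim])
  ultimately show "moment \<phi> t = \<phi> i + rl_integral \<alpha> (moment (generator \<phi>)) t"
    using LIMSEQ_unique by simp
qed

section \<open>Mean and variance\<close>

lemma real_le_quadratic: "\<bar>real n\<bar> \<le> 1 * (1 + (real n)\<^sup>2)"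
  using sum_squares_ge_zero[of "real n - 1" "real n"] by (simp add: power2_eq_square algebra_simps)

lemma square_le_quadratic: "\<bar>(real n)\<^sup>2\<bar> \<le> 1 * (1 + (real n)\<^sup>2)"
  by simp

abbreviation "mean \<equiv> moment real"
abbreviation "mean_square \<equiv> moment (\<lambda>n. (real n)\<^sup>2)"
abbreviation "empty_prob \<equiv> moment (indicator {0})"

lemma locally_bounded_moments:
  "locally_bounded mean" "locally_bounded mean_square" "locally_bounded empty_prob"
  using locally_bounded_moment_quadratic[OF real_le_quadratic]
    locally_bounded_moment_quadratic[OF square_le_quadratic]
    locally_bounded_moment_bounded[of "indicator {0}" 1] by (auto simp: indicator_def)

lemma moment_finite_real: "moment_finite real"
  by (rule moment_finite_quadratic[OF real_le_quadratic])

text \<open>The generator maps the function \<open>n\<close> to \<open>lam - \<mu> + \<mu> [n = 0] - \<xi> n\<close>, and \<open>n\<^sup>2\<close> to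
  \<open>lam + \<mu> - \<mu> [n = 0] + 2 (lam - \<mu>) n - \<xi> n\<^sup>2\<close>: the service that is missing at the empty queue brings
  in the probability of \<open>0\<close>, and otherwise the equations for the first two moments are closed.\<close>

lemma volterra_mean:
  assumes "0 < t"
  shows "mean t = real i + rl_integral \<alpha> (\<lambda>s. ((lam - \<mu>) + \<mu> * empty_prob s) + (- \<xi>) * mean s) t"
proof -
  have "generator real = (\<lambda>n. ((lam - \<mu>) + \<mu> * indicator {0} n) + (- \<xi>) * real n)"
    by (auto simp: fun_eq_iff generator_def indicator_def of_nat_diff algebra_simps)
  then have "moment (generator real) s = ((lam - \<mu>) + \<mu> * empty_prob s) + (- \<xi>) * mean s" if "0 < s" for s
    using that by (simp only: moment_add moment_cmult moment_const moment_finite_add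
        moment_finite_cmult moment_finite_indicator moment_finite_const moment_finite_real)
  then have "rl_integral \<alpha> (moment (generator real)) t =
      rl_integral \<alpha> (\<lambda>s. ((lam - \<mu>) + \<mu> * empty_prob s) + (- \<xi>) * mean s) t"
    by (intro rl_integral_cong)
  then show ?thesis
    using dynkin_quadratic[OF real_le_quadratic] assms by (simp add: dynkin_def)
qed

lemma volterra_mean_square:
  assumes "0 < t"
  shows "mean_square t = (real i)\<^sup>2 + rl_integral \<alpha> (\<lambda>s.
    ((lam + \<mu>) + ((- \<mu>) * empty_prob s + (2 * (lam - \<mu>)) * mean s)) + (- \<xi>) * mean_square s) t"
proof -
  have "generator (\<lambda>n. (real n)\<^sup>2) = (\<lambda>n. ((lam + \<mu>) + ((- \<mu>) * indicator {0} n +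
      (2 * (lam - \<mu>)) * real n)) + (- \<xi>) * (real n)\<^sup>2)"
    by (auto simp: fun_eq_iff generator_def indicator_def of_nat_diff power2_eq_square algebra_simps)
  then have "moment (generator (\<lambda>n. (real n)\<^sup>2)) s = ((lam + \<mu>) + ((- \<mu>) * empty_prob s +
      (2 * (lam - \<mu>)) * mean s)) + (- \<xi>) * mean_square s" if "0 < s" for s
    using that by (simp only: moment_add moment_cmult moment_const moment_finite_add
        moment_finite_cmult moment_finite_indicator moment_finite_const moment_finite_real
        moment_finite_square)
  then have "rl_integral \<alpha> (moment (generator (\<lambda>n. (real n)\<^sup>2))) t = rl_integral \<alpha> (\<lambda>s.
      ((lam + \<mu>) + ((- \<mu>) * empty_prob s + (2 * (lam - \<mu>)) * mean s)) + (- \<xi>) * mean_square s) t"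
    by (intro rl_integral_cong)
  then show ?thesis
    using dynkin_quadratic[OF square_le_quadratic] assms by (simp add: dynkin_def)
qed

lemma ml_convolution_mean_inhomogeneity:
  assumes "0 < t" "0 < \<delta>" "0 < \<gamma>"
  shows "ml_convolution \<delta> \<alpha> \<gamma> (- \<xi>) (\<lambda>s. (lam - \<mu>) + \<mu> * empty_prob s) t =
    (lam - \<mu>) * (t powr \<gamma> * mittag_leffler3 \<delta> \<alpha> (\<gamma> + 1) (- \<xi> * t powr \<alpha>)) +
    \<mu> * ml_convolution \<delta> \<alpha> \<gamma> (- \<xi>) empty_prob t"
  using assms order locally_bounded_moments
  by (simp add: ml_convolution_add ml_convolution_cmult ml_convolution_const
      locally_bounded_const locally_bounded_cmult)

lemma mean_eq:
  assumes "0 < t"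
  shows "mean t = real i * mittag_leffler3 1 \<alpha> 1 (- \<xi> * t powr \<alpha>)
    + \<mu> * ml_convolution 1 \<alpha> \<alpha> (- \<xi>) empty_prob t
    + (lam - \<mu>) / \<xi> * (1 - mittag_leffler3 1 \<alpha> 1 (- \<xi> * t powr \<alpha>))"
proof -
  have "mean t = real i * mittag_leffler3 1 \<alpha> 1 (- \<xi> * t powr \<alpha>) +
      ml_convolution 1 \<alpha> \<alpha> (- \<xi>) (\<lambda>s. (lam - \<mu>) + \<mu> * empty_prob s) t"
    by (rule volterra_solution[OF _ _ _ _ volterra_mean])
       (use assms order in \<open>auto intro!: locally_bounded_moments locally_bounded_add
          locally_bounded_cmult locally_bounded_const\<close>)
  moreover have "t powr \<alpha> * mittag_leffler3 1 \<alpha> (\<alpha> + 1) (- \<xi> * t powr \<alpha>) =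
      (1 - mittag_leffler3 1 \<alpha> 1 (- \<xi> * t powr \<alpha>)) / \<xi>"
    using mittag_leffler3_1_recurrence[OF order(1), of "- \<xi> * t powr \<alpha>"] \<xi>_pos
    by (simp add: field_simps)
  ultimately show ?thesis
    using ml_convolution_mean_inhomogeneity[OF assms, of 1 \<alpha>] order by simp
qed

lemma mean_square_eq:
  assumes "0 < t"
  shows "mean_square t = (real i)\<^sup>2 * mittag_leffler3 1 \<alpha> 1 (- \<xi> * t powr \<alpha>)
    + 2 * real i * t powr \<alpha> * (lam - \<mu>) * mittag_leffler3 2 \<alpha> (\<alpha> + 1) (- \<xi> * t powr \<alpha>)
    - \<mu> * ml_convolution 1 \<alpha> \<alpha> (- \<xi>) empty_prob t
    + 2 * \<mu> * (lam - \<mu>) * ml_convolution 2 \<alpha> (2 * \<alpha>) (- \<xi>) empty_prob t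
    + (\<mu> + lam) * t powr \<alpha> * mittag_leffler3 1 \<alpha> (\<alpha> + 1) (- \<xi> * t powr \<alpha>)
    + 2 * t powr (2 * \<alpha>) * (lam - \<mu>)\<^sup>2 * mittag_leffler3 2 \<alpha> (2 * \<alpha> + 1) (- \<xi> * t powr \<alpha>)"
proof -
  note lb = locally_bounded_moments locally_bounded_add locally_bounded_cmult locally_bounded_const
  have "mean_square t = (real i)\<^sup>2 * mittag_leffler3 1 \<alpha> 1 (- \<xi> * t powr \<alpha>) +
      ml_convolution 1 \<alpha> \<alpha> (- \<xi>)
        (\<lambda>s. (lam + \<mu>) + ((- \<mu>) * empty_prob s + (2 * (lam - \<mu>)) * mean s)) t"
    by (rule volterra_solution[OF _ _ _ _ volterra_mean_square])
       (intro lb assms order | assumption)+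
  also have "ml_convolution 1 \<alpha> \<alpha> (- \<xi>)
        (\<lambda>s. (lam + \<mu>) + ((- \<mu>) * empty_prob s + (2 * (lam - \<mu>)) * mean s)) t =
      (lam + \<mu>) * (t powr \<alpha> * mittag_leffler3 1 \<alpha> (\<alpha> + 1) (- \<xi> * t powr \<alpha>)) +
      ((- \<mu>) * ml_convolution 1 \<alpha> \<alpha> (- \<xi>) empty_prob t +
       (2 * (lam - \<mu>)) * ml_convolution 1 \<alpha> \<alpha> (- \<xi>) mean t)"
    using assms order
    by (simp only: ml_convolution_add ml_convolution_cmult ml_convolution_const lb zero_less_one)
      (simp only: distrib_right)
  also have "ml_convolution 1 \<alpha> \<alpha> (- \<xi>) mean t =
      real i * (t powr \<alpha> * mittag_leffler3 2 \<alpha> (\<alpha> + 1) (- \<xi> * t powr \<alpha>)) +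
      ml_convolution 2 \<alpha> (2 * \<alpha>) (- \<xi>) (\<lambda>s. (lam - \<mu>) + \<mu> * empty_prob s) t"
    by (rule ml_convolution_volterra_solution[OF _ _ _ _ volterra_mean])
       (intro lb assms order | assumption)+
  also have "ml_convolution 2 \<alpha> (2 * \<alpha>) (- \<xi>) (\<lambda>s. (lam - \<mu>) + \<mu> * empty_prob s) t =
      (lam - \<mu>) * (t powr (2 * \<alpha>) * mittag_leffler3 2 \<alpha> (2 * \<alpha> + 1) (- \<xi> * t powr \<alpha>)) +
      \<mu> * ml_convolution 2 \<alpha> (2 * \<alpha>) (- \<xi>) empty_prob t"
    by (rule ml_convolution_mean_inhomogeneity) (use assms order in auto)
  finally show ?thesis
    by (simp add: power2_eq_square algebra_simps)
qed

end

theorem theorem2p6: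
  fixes M :: "'a measure" and X :: "real \<Rightarrow> 'a \<Rightarrow> nat"
    and \<alpha> lam \<mu> \<xi> t :: real and i :: nat
  assumes "fractional_mm1_queue M X \<alpha> lam \<mu> \<xi>"
    and "0 < \<xi>"
    and "AE \<omega> in M. X 0 \<omega> = i"
    and "0 < t"
  shows "integrable M (\<lambda>\<omega>. (real (X t \<omega>))\<^sup>2) \<and>
    prob_space.variance M (\<lambda>\<omega>. real (X t \<omega>)) =
      (real i)\<^sup>2 * mittag_leffler3 1 \<alpha> 1 (- \<xi> * t powr \<alpha>)
      + 2 * real i * t powr \<alpha> * (lam - \<mu>) * mittag_leffler3 2 \<alpha> (\<alpha> + 1) (- \<xi> * t powr \<alpha>)
      - \<mu> * time_convolution (trans_prob M X i 0)
              (\<lambda>u. u powr (\<alpha> - 1) * mittag_leffler3 1 \<alpha> \<alpha> (- \<xi> * u powr \<alpha>)) t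
      + 2 * \<mu> * (lam - \<mu>) * time_convolution (trans_prob M X i 0)
              (\<lambda>u. u powr (2 * \<alpha> - 1) * mittag_leffler3 2 \<alpha> (2 * \<alpha>) (- \<xi> * u powr \<alpha>)) t
      + (\<mu> + lam) * t powr \<alpha> * mittag_leffler3 1 \<alpha> (\<alpha> + 1) (- \<xi> * t powr \<alpha>)
      + 2 * t powr (2 * \<alpha>) * (lam - \<mu>)\<^sup>2
          * mittag_leffler3 2 \<alpha> (2 * \<alpha> + 1) (- \<xi> * t powr \<alpha>)
      - (real i * mittag_leffler3 1 \<alpha> 1 (- \<xi> * t powr \<alpha>)
         + \<mu> * time_convolution (trans_prob M X i 0)
                 (\<lambda>u. u powr (\<alpha> - 1) * mittag_leffler3 1 \<alpha> \<alpha> (- \<xi> * u powr \<alpha>)) t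
         + (lam - \<mu>) / \<xi> * (1 - mittag_leffler3 1 \<alpha> 1 (- \<xi> * t powr \<alpha>)))\<^sup>2"
proof -
  interpret fractional_mm1_queue_from M X \<alpha> lam \<mu> \<xi> i
    using assms by (simp add: fractional_mm1_queue_from_def fractional_mm1_queue_from_axioms_def)
  have conv: "time_convolution (trans_prob M X i 0)
      (\<lambda>u. u powr (\<gamma> - 1) * mittag_leffler3 \<delta> \<alpha> \<gamma> (- \<xi> * u powr \<alpha>)) t =
      ml_convolution \<delta> \<alpha> \<gamma> (- \<xi>) empty_prob t" for \<delta> \<gamma>
    unfolding ml_convolution_def
    by (rule time_convolution_cong) (use assms(4) in \<open>auto simp: moment_indicator\<close>)
  have int: "integrable M (\<lambda>\<omega>. real (X t \<omega>))" "integrable M (\<lambda>\<omega>. (real (X t \<omega>))\<^sup>2)"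
    using moment_finite_real moment_finite_square assms(4) by (auto simp: moment_finite_def)
  have "variance (\<lambda>\<omega>. real (X t \<omega>)) = mean_square t - (mean t)\<^sup>2"
    using variance_eq[OF int] assms(4) by (simp add: moment_def)
  then show ?thesis
    using int(2) unfolding conv mean_eq[OF assms(4)] mean_square_eq[OF assms(4)] by blast
qed

end
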